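(* For every integer $n\ge 3$, the $3$-rainbow index of the wheel $W_n$ is $$rx_3(W_n)=\begin{cases}2, & n=3;\\ 3, & 4\le n\le 6;\\ 4, & 7\le n\le 16;\\ 5, & n\ge 17.\end{cases}$$
   Context: All graphs are finite, simple and undirected. Edge-colorings are arbitrary maps from $E(G)$ to a finite set of colors (adjacent edges may receive the same color). A tree $T$ that is a subgraph of an edge-colored graph $G$ is a rainbow tree if no two edges of $T$ have the same color. For $S\subseteq V(G)$, a rainbow $S$-tree is a rainbow tree in $G$ whose vertex set contains $S$ (it may contain other vertices). For a connected graph $G$ of order at least $3$, $rx_3(G)$ (the $3$-rainbow index) is the minimum number of colors in an edge-coloring of $G$ such that for every $3$-element subset $S$ of $V(G)$ there is a rainbow $S$-tree. For $n\ge 3$, the wheel $W_n$ is the graph on $n+1$ vertices obtained from a cycle $C_n$ on $n$ vertices by adding one new vertex $v$ and joining it to every vertex of the cycle. *)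

theory Defs
  imports Main
begin

record 'a ugraph =
  verts :: "'a set"
  edges :: "'a set set"

definition simple_graph :: "'a ugraph \<Rightarrow> bool" where
  "simple_graph G \<longleftrightarrow>
     finite (verts G) \<and> (\<forall>e\<in>edges G. e \<subseteq> verts G \<and> card e = 2)"

definition subgraph :: "'a ugraph \<Rightarrow> 'a ugraph \<Rightarrow> bool" where
  "subgraph H G \<longleftrightarrow>
     simple_graph H \<and> simple_graph G \<and> verts H \<subseteq> verts G \<and> edges H \<subseteq> edges G"

definition connected_graph :: "'a ugraph \<Rightarrow> bool" where
  "connected_graph G \<longleftrightarrow> verts G \<noteq> {} \<and>
     (\<forall>u\<in>verts G. \<forall>v\<in>verts G. (u, v) \<in> {(x, y). {x, y} \<in> edges G}\<^sup>*)"

text \<open>A cycle is given by the list of its vertices; the edge from the last vertex back to the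
  first is the case \<open>i = length p - 1\<close>.\<close>

definition is_cycle :: "'a ugraph \<Rightarrow> 'a list \<Rightarrow> bool" where
  "is_cycle G p \<longleftrightarrow> 3 \<le> length p \<and> distinct p \<and>
     (\<forall>i<length p. {p ! i, p ! (Suc i mod length p)} \<in> edges G)"

definition is_tree :: "'a ugraph \<Rightarrow> bool" where
  "is_tree T \<longleftrightarrow> simple_graph T \<and> connected_graph T \<and> (\<nexists>p. is_cycle T p)"

definition rainbow_tree :: "'a ugraph \<Rightarrow> ('a set \<Rightarrow> 'c) \<Rightarrow> 'a ugraph \<Rightarrow> bool" where
  "rainbow_tree G c T \<longleftrightarrow> subgraph T G \<and> is_tree T \<and> inj_on c (edges T)"

definition rainbow_S_tree :: "'a ugraph \<Rightarrow> ('a set \<Rightarrow> 'c) \<Rightarrow> 'a set \<Rightarrow> 'a ugraph \<Rightarrow> bool" where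
  "rainbow_S_tree G c S T \<longleftrightarrow> rainbow_tree G c T \<and> S \<subseteq> verts T"

definition rainbow_coloring3 :: "'a ugraph \<Rightarrow> ('a set \<Rightarrow> 'c) \<Rightarrow> bool" where
  "rainbow_coloring3 G c \<longleftrightarrow>
     (\<forall>S. S \<subseteq> verts G \<and> card S = 3 \<longrightarrow> (\<exists>T. rainbow_S_tree G c S T))"

text \<open>Colors are natural numbers, which is no restriction because only finitely many colors occur
  on a finite graph; values of \<open>c\<close> outside \<open>edges G\<close> are irrelevant. The definition is meaningful
  for connected graphs, where coloring all edges differently satisfies the condition, so that the
  minimum exists.\<close>

definition rx3 :: "'a ugraph \<Rightarrow> nat" where
  "rx3 G = (LEAST k. \<exists>c :: 'a set \<Rightarrow> nat. rainbow_coloring3 G c \<and> card (c ` edges G) = k)"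

text \<open>The vertices of the cycle are \<open>0, \<dots>, n - 1\<close>, and \<open>n\<close> is the additional vertex (the hub) of the
  wheel. These are the intended graphs only for \<open>n \<ge> 3\<close>.\<close>

definition cycle_graph :: "nat \<Rightarrow> nat ugraph" where
  "cycle_graph n = \<lparr>verts = {..<n}, edges = {{i, Suc i mod n} |i. i < n}\<rparr>"

definition wheel :: "nat \<Rightarrow> nat ugraph" where
  "wheel n = \<lparr>verts = insert n (verts (cycle_graph n)),
              edges = edges (cycle_graph n) \<union> {{n, i} |i. i \<in> verts (cycle_graph n)}\<rparr>"

lemma simple_graph_wheel:
  assumes "n \<ge> 3"
  shows "simple_graph (wheel n)"
proof -
  have "i \<noteq> Suc i mod n" if "i < n" for i
    using that assms by (cases "Suc i = n") auto
  then show ?thesis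
    by (auto simp: simple_graph_def wheel_def cycle_graph_def card_2_iff doubleton_eq_iff)
qed

lemma card_verts_wheel: "card (verts (wheel n)) = n + 1"
  by (simp add: wheel_def cycle_graph_def)

lemma connected_graph_wheel: "connected_graph (wheel n)"
proof -
  let ?R = "{(x, y). {x, y} \<in> edges (wheel n)}\<^sup>*"
  have "(u, n) \<in> ?R \<and> (n, u) \<in> ?R" if "u \<in> verts (wheel n)" for u
  proof (cases "u = n")
    case False
    then have "{n, u} \<in> edges (wheel n)"
      using that by (auto simp: wheel_def)
    then show ?thesis
      by (auto simp: insert_commute intro: r_into_rtrancl)
  qed simp
  then show ?thesis
    unfolding connected_graph_def by (auto simp: wheel_def intro: rtrancl_trans)
qed

end

theory Submission
  imports Defs "HOL-Library.FuncSet"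
begin

text \<open>Two reductions make both directions local. A connected graph has a spanning tree, so a rainbow
\<open>S\<close>-tree exists as soon as there is a connected subgraph containing \<open>S\<close> on which the colouring is
injective (\<open>rainbow_coloring3_if_connected_subgraphs\<close>). Conversely a connected subgraph with at most
\<open>k\<close> edges has at most \<open>k + 1\<close> vertices, so with \<open>k\<close> colours a rainbow tree for \<open>S\<close> has at most
\<open>k - 2\<close> vertices outside \<open>S\<close>. Thus everything is decided by a few vertices near \<open>S\<close> and the hub.

Upper bounds. Three rim vertices are joined through the hub by three legs, where a leg follows the
rim for a few edges and then takes a spoke. For \<open>4 \<le> n \<le> 16\<close> there are explicit colourings, and
suitable legs for all triples are found by evaluation. For \<open>n = 3\<close> the wheel is complete
and two colours without a monochromatic triangle suffice. For arbitrary \<open>n\<close>, five colours suffice: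
the spokes repeat the colours 0, 1, 2, the rim edges alternate between 3 and 4, and the at most two
left-over spokes get the colours 3 and 4. Spokes of equal colours are separated by sliding
one or two of the three vertices to a neighbour, which costs one rim edge each.

Lower bounds. If the three vertices are not in a short arc of the rim, a rainbow tree for them must
contain the hub. For \<open>k = 3\<close> the only vertices are then the hub and \<open>S\<close>. Hence two spokes at
distance two never have the same colour (take the vertex two steps further as third element of
\<open>S\<close>), and three spokes of one colour no two of which are at distance two have no rainbow tree either; but
among seven spokes three have the same colour. For \<open>k = 2\<close> the tree has no vertices outside \<open>S\<close>,
which fails for a triple with an isolated vertex if \<open>n \<ge> 5\<close>; only \<open>n = 4\<close> needs a discussion of
all edges. For \<open>k = 4\<close> there is one more vertex, which can serve to replace one spoke by a neighbouring spoke and a rim edge. Among 17 spokes five have the same colour.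
Three of them cannot be pairwise at distance at least three, because two replacements
would be needed, and three consecutive ones cannot occur together with a further one at distance at
least three from them. So the five are consecutive, say at \<open>a, \<dots>, a + 4\<close>. For a position \<open>u\<close> far from
them, the tree for \<open>a + 1, a + 4, u\<close> can only leave the monochromatic block through \<open>a + 5\<close>, which
determines the colour of the spoke at \<open>u\<close>. Since the rim has at least 17 vertices, there are three
such positions pairwise far apart, all with the same spoke colour, and this was excluded.\<close>

section \<open>Connected graphs, spanning trees and rainbow subgraphs\<close>

lemma connected_graph_cut:
  assumes "simple_graph G" "connected_graph G" "U \<subset> verts G" "U \<noteq> {}"
  shows "\<exists>u\<in>U. \<exists>v\<in>verts G - U. {u, v} \<in> edges G"
proof -
  obtain x y where xy: "x \<in> U" "y \<in> verts G" "y \<notin> U"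
    using assms(3,4) by auto
  then have "(x, y) \<in> {(x, y). {x, y} \<in> edges G}\<^sup>*"
    using assms(2,3) unfolding connected_graph_def by blast
  then have "y \<in> U \<or> (\<exists>u\<in>U. \<exists>v. v \<notin> U \<and> {u, v} \<in> edges G)"
    by (induction rule: rtrancl_induct) (use xy in auto)
  then show ?thesis
    using xy assms(1) unfolding simple_graph_def by blast
qed

text \<open>Along a growing connected vertex set, every new vertex is attached by an edge that was not yet used.\<close>

lemma connected_graph_card_verts_le:
  assumes G: "simple_graph G" "connected_graph G"
  shows "card (verts G) \<le> card (edges G) + 1"
proof -
  have fin: "finite (verts G)" "finite (edges G)"
    using G(1) by (auto simp: simple_graph_def intro: finite_subset[of _ "Pow (verts G)"])
  have "\<exists>U F. U \<subseteq> verts G \<and> card U = Suc m \<and> F \<subseteq> edges G \<and> \<Union>F \<subseteq> U \<and> card F = m"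
    if "m < card (verts G)" for m
    using that
  proof (induction m)
    case 0
    then obtain v where "v \<in> verts G"
      by fastforce
    then show ?case
      by (intro exI[of _ "{v}"] exI[of _ "{}"]) auto
  next
    case (Suc m)
    then obtain U F where UF: "U \<subseteq> verts G" "card U = Suc m" "F \<subseteq> edges G" "\<Union>F \<subseteq> U" "card F = m"
      by auto
    then have "U \<subset> verts G" "U \<noteq> {}"
      using Suc.prems by auto
    then obtain u v where uv: "u \<in> U" "v \<in> verts G - U" "{u, v} \<in> edges G"
      using connected_graph_cut[OF G] by blast
    have "finite U" "finite F"
      using UF(1,3) fin finite_subset by blast+
    moreover have "{u, v} \<notin> F"
      using uv UF(4) by auto
    ultimately show ?case
      using UF uv by (intro exI[of _ "insert v U"] exI[of _ "insert {u, v} F"]) auto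
  qed
  from this[of "card (verts G) - 1"] show ?thesis
    using fin card_mono[OF fin(2)] by (cases "card (verts G)") fastforce+
qed

lemma rtrancl_doubleton_sym:
  "(x, y) \<in> {(x, y). {x, y} \<in> E}\<^sup>* \<Longrightarrow> (y, x) \<in> {(x, y). {x, y} \<in> E}\<^sup>*"
  by (rule symD[OF sym_rtrancl]) (auto simp: sym_def insert_commute)

text \<open>The remaining edges of the cycle form a path that replaces the removed edge.\<close>

lemma connected_graph_remove_cycle_edge:
  assumes conn: "connected_graph \<lparr>verts = V, edges = E\<rparr>"
    and cyc: "is_cycle \<lparr>verts = V, edges = E\<rparr> p"
  shows "connected_graph \<lparr>verts = V, edges = E - {{last p, hd p}}\<rparr>"
proof -
  let ?R = "{(x, y). {x, y} \<in> E}" and ?R' = "{(x, y). {x, y} \<in> E - {{last p, hd p}}}"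
  from cyc have len: "3 \<le> length p" and dist: "distinct p"
    and pE: "\<And>i. i < length p \<Longrightarrow> {p ! i, p ! (Suc i mod length p)} \<in> E"
    by (auto simp: is_cycle_def)
  have ne: "p \<noteq> []"
    using len by auto
  have ends: "hd p = p ! 0" "last p = p ! (length p - 1)"
    using ne by (simp_all add: hd_conv_nth last_conv_nth)
  have "(p ! 0, p ! i) \<in> ?R'\<^sup>*" if "i < length p" for i
    using that
  proof (induction i)
    case (Suc i)
    have "{p ! i, p ! Suc i} \<in> E"
      using pE[of i] Suc.prems by simp
    moreover have "{p ! i, p ! Suc i} \<noteq> {last p, hd p}"
    proof -
      have "i < length p" "Suc i < length p" "0 < length p" "length p - 1 < length p"
        using Suc.prems by auto
      moreover have "i \<noteq> length p - 1" "\<not> (i = 0 \<and> Suc i = length p - 1)"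
        using Suc.prems len by auto
      ultimately show ?thesis
        unfolding ends doubleton_eq_iff by (simp only: nth_eq_iff_index_eq[OF dist]) blast
    qed
    ultimately have "(p ! i, p ! Suc i) \<in> ?R'"
      by simp
    then show ?case
      using Suc by (meson Suc_lessD rtrancl.rtrancl_into_rtrancl)
  qed simp
  from this[of "length p - 1"] have bridge: "(hd p, last p) \<in> ?R'\<^sup>*"
    unfolding ends using len by simp
  have "(x, y) \<in> ?R'\<^sup>*" if "(x, y) \<in> ?R" for x y
  proof (cases "{x, y} = {last p, hd p}")
    case True
    then show ?thesis
      using bridge rtrancl_doubleton_sym[OF bridge] by (auto simp: doubleton_eq_iff)
  qed (use that in auto)
  then have "?R\<^sup>* \<subseteq> ?R'\<^sup>*"
    by (intro rtrancl_subset_rtrancl) auto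
  then show ?thesis
    using conn unfolding connected_graph_def by auto
qed

text \<open>A connected spanning subgraph with the fewest edges contains no cycle.\<close>

lemma spanning_tree_exists:
  assumes "simple_graph G" "connected_graph G"
  shows "\<exists>E\<subseteq>edges G. is_tree \<lparr>verts = verts G, edges = E\<rparr>"
proof -
  define good where
    "good E \<longleftrightarrow> E \<subseteq> edges G \<and> connected_graph \<lparr>verts = verts G, edges = E\<rparr>" for E
  have fin: "finite (edges G)"
    using assms(1) by (auto simp: simple_graph_def intro: finite_subset[of _ "Pow (verts G)"])
  have "good (edges G)"
    using assms(2) by (simp add: good_def connected_graph_def)
  then obtain E where E: "good E" and min: "\<And>F. good F \<Longrightarrow> card E \<le> card F"
    using ex_has_least_nat[of good "edges G" card] by auto
  have "\<not> is_cycle \<lparr>verts = verts G, edges = E\<rparr> p" for p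
  proof
    assume cyc: "is_cycle \<lparr>verts = verts G, edges = E\<rparr> p"
    then have len: "3 \<le> length p"
      by (simp add: is_cycle_def)
    then have "p \<noteq> []"
      by auto
    with cyc len have "{last p, hd p} \<in> E"
      unfolding is_cycle_def by (auto simp: last_conv_nth hd_conv_nth dest!: spec[of _ "length p - 1"])
    moreover have "finite E"
      using E fin finite_subset by (auto simp: good_def)
    ultimately have "card (E - {{last p, hd p}}) < card E"
      by (intro card_Diff1_less)
    moreover have "good (E - {{last p, hd p}})"
      using E connected_graph_remove_cycle_edge[OF _ cyc] by (auto simp: good_def)
    ultimately show False
      using min by fastforce
  qed
  then show ?thesis
    using E assms(1) by (intro exI[of _ E]) (auto simp: is_tree_def good_def simple_graph_def)
qed

lemma rainbow_coloring3_if_connected_subgraphs: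
  assumes "\<And>S. S \<subseteq> verts G \<Longrightarrow> card S = 3 \<Longrightarrow>
    \<exists>H. subgraph H G \<and> connected_graph H \<and> inj_on c (edges H) \<and> S \<subseteq> verts H"
  shows "rainbow_coloring3 G c"
  unfolding rainbow_coloring3_def
proof (intro allI impI, elim conjE)
  fix S assume "S \<subseteq> verts G" "card S = 3"
  then obtain H where H: "subgraph H G" "connected_graph H" "inj_on c (edges H)" "S \<subseteq> verts H"
    using assms by blast
  then obtain E where "E \<subseteq> edges H" "is_tree \<lparr>verts = verts H, edges = E\<rparr>"
    using spanning_tree_exists[of H] by (auto simp: subgraph_def)
  then show "\<exists>T. rainbow_S_tree G c S T"
    using H by (intro exI[of _ "\<lparr>verts = verts H, edges = E\<rparr>"])
      (auto simp: rainbow_S_tree_def rainbow_tree_def subgraph_def is_tree_def intro: inj_on_subset)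
qed

section \<open>Wheels with rim positions in the integers\<close>

text \<open>Rim vertices are indexed by integers modulo \<open>n\<close>, with period \<open>n\<close>. In this way arguments about
the cyclic order become linear arithmetic on representatives.\<close>

definition rim_vertex :: "nat \<Rightarrow> int \<Rightarrow> nat" where
  "rim_vertex n i = nat (i mod int n)"

definition spoke :: "nat \<Rightarrow> int \<Rightarrow> nat set" where
  "spoke n i = {n, rim_vertex n i}"

definition rim :: "nat \<Rightarrow> int \<Rightarrow> nat set" where
  "rim n i = {rim_vertex n i, rim_vertex n (i + 1)}"

lemma rim_vertex_less: "0 < n \<Longrightarrow> rim_vertex n i < n"
  by (simp add: rim_vertex_def nat_less_iff)

lemma rim_vertex_of_nat: "i < n \<Longrightarrow> rim_vertex n (int i) = i"
  by (simp add: rim_vertex_def)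

lemma rim_vertex_Suc: "i < n \<Longrightarrow> rim_vertex n (int i + 1) = Suc i mod n"
  unfolding rim_vertex_def by (metis nat_int of_nat_Suc of_nat_mod add.commute)

lemma rim_vertex_eq_iff_dvd: "0 < n \<Longrightarrow> rim_vertex n i = rim_vertex n j \<longleftrightarrow> int n dvd i - j"
  by (simp add: rim_vertex_def mod_eq_dvd_iff[symmetric] eq_nat_nat_iff)

lemma rim_vertex_add_period: "rim_vertex n (i + int n) = rim_vertex n i"
  by (simp add: rim_vertex_def)

lemma spoke_add_period: "spoke n (i + int n) = spoke n i"
  by (simp add: spoke_def rim_vertex_add_period)

text \<open>This is the form in which congruences are decided below: all representatives in play
differ by less than one period.\<close>

lemma rim_vertex_eq_iff:
  assumes "0 < n" "\<bar>i - j\<bar> < int n"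
  shows "rim_vertex n i = rim_vertex n j \<longleftrightarrow> i = j"
  using assms dvd_imp_le_int[of "i - j" "int n"] by (fastforce simp: rim_vertex_eq_iff_dvd)

lemma rim_vertex_cong_add:
  "rim_vertex n i = rim_vertex n j \<Longrightarrow> 0 < n \<Longrightarrow> rim_vertex n (i + t) = rim_vertex n (j + t)"
  by (simp add: rim_vertex_eq_iff_dvd)

lemma obtain_rim_vertex:
  assumes "v < n"
  obtains i where "v = rim_vertex n i" "0 \<le> i" "i < int n"
  using that[of "int v"] assms by (simp add: rim_vertex_of_nat)

lemma verts_wheel: "verts (wheel n) = {..n}"
  by (auto simp: wheel_def cycle_graph_def)

lemma edges_wheel: "edges (wheel n) = spoke n ` {0..<int n} \<union> rim n ` {0..<int n}"
proof -
  have "{0..<int n} = int ` {..<n}"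
    by (metis atLeast0LessThan image_int_atLeastLessThan of_nat_0)
  then show ?thesis
    by (auto simp: wheel_def cycle_graph_def spoke_def rim_def image_image rim_vertex_of_nat rim_vertex_Suc)
qed

lemma spoke_in_wheel: "0 < n \<Longrightarrow> spoke n i \<in> edges (wheel n)"
  unfolding edges_wheel by (rule UnI1, rule image_eqI[of _ _ "i mod int n"]) (auto simp: spoke_def rim_vertex_def)

lemma rim_in_wheel: "0 < n \<Longrightarrow> rim n i \<in> edges (wheel n)"
  unfolding edges_wheel
  by (rule UnI2, rule image_eqI[of _ _ "i mod int n"]) (auto simp: rim_def rim_vertex_def mod_simps)

lemma wheel_neighbours:
  assumes "0 < n" "{rim_vertex n i, v} \<in> edges (wheel n)"
  shows "v = n \<or> v = rim_vertex n (i + 1) \<or> v = rim_vertex n (i - 1)"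
proof -
  note less = rim_vertex_less[OF assms(1)]
  consider j where "{rim_vertex n i, v} = spoke n j" | j where "{rim_vertex n i, v} = rim n j"
    using assms(2) unfolding edges_wheel by blast
  then show ?thesis
  proof cases
    case 1
    then show ?thesis
      using less[of i] by (auto simp: spoke_def doubleton_eq_iff)
  next
    case 2
    then consider "rim_vertex n i = rim_vertex n j" "v = rim_vertex n (j + 1)"
      | "rim_vertex n i = rim_vertex n (j + 1)" "v = rim_vertex n j"
      by (auto simp: rim_def doubleton_eq_iff)
    then show ?thesis
      using rim_vertex_cong_add[of n i j 1] rim_vertex_cong_add[of n i "j + 1" "-1"] assms(1)
      by cases auto
  qed
qed

section \<open>Connected subgraphs made of legs to the hub\<close>

lemma obtain_ordered_triple:
  fixes S :: "'a :: linorder set"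
  assumes "card S = 3"
  obtains x y z where "S = {x, y, z}" "x < y" "y < z"
proof -
  have fin: "finite S"
    using assms by (auto intro: card_ge_0_finite)
  have "length (sorted_list_of_set S) = 3"
    using assms by simp
  then obtain x y z where xyz: "sorted_list_of_set S = [x, y, z]"
    by (auto simp: length_Suc_conv eval_nat_numeral simp del: length_sorted_list_of_set)
  then have "S = {x, y, z}" "sorted_wrt (<) [x, y, z]"
    using set_sorted_list_of_set[OF fin, unfolded xyz] strict_sorted_list_of_set[of S, unfolded xyz]
    by simp_all
  then show thesis
    using that by auto
qed

text \<open>A leg starts at rim position \<open>x\<close>, follows the rim by \<open>d\<close> steps (backwards if \<open>d < 0\<close>) and
ends with the spoke at \<open>x + d\<close>.\<close>

definition leg :: "nat \<Rightarrow> int \<Rightarrow> int \<Rightarrow> nat set set" where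
  "leg n x d = insert (spoke n (x + d)) (rim n ` {min x (x + d)..<max x (x + d)})"

lemma leg_in_wheel: "0 < n \<Longrightarrow> leg n x d \<subseteq> edges (wheel n)"
  by (auto simp: leg_def spoke_in_wheel rim_in_wheel)

lemma leg_reaches_hub:
  assumes "min x (x + d) \<le> y" "y \<le> max x (x + d)" "leg n x d \<subseteq> E"
  shows "(rim_vertex n y, n) \<in> {(u, v). {u, v} \<in> E}\<^sup>*"
proof -
  let ?R = "{(u, v). {u, v} \<in> E}"
  have foot: "(rim_vertex n (x + d), n) \<in> ?R"
    using assms(3) by (auto simp: leg_def spoke_def insert_commute)
  have rimE: "rim n i \<in> E" if "min x (x + d) \<le> i" "i < max x (x + d)" for i
    using that assms(3) by (auto simp: leg_def)
  show ?thesis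
  proof (cases "y \<le> x + d")
    case True
    then show ?thesis
      using assms(1)
    proof (induction rule: int_le_induct)
      case base
      then show ?case using foot by auto
    next
      case (step i)
      have "rim n (i - 1) \<in> E"
        using step assms by (intro rimE) auto
      then have "(rim_vertex n (i - 1), rim_vertex n i) \<in> ?R"
        by (simp add: rim_def)
      moreover have "(rim_vertex n i, n) \<in> ?R\<^sup>*"
        using step by auto
      ultimately show ?case
        by (rule converse_rtrancl_into_rtrancl)
    qed
  next
    case False
    then have "x + d \<le> y" by simp
    then show ?thesis
      using assms(2)
    proof (induction rule: int_ge_induct)
      case base
      then show ?case using foot by auto
    next
      case (step i)
      have "rim n i \<in> E"
        using step assms by (intro rimE) auto
      then have "(rim_vertex n (i + 1), rim_vertex n i) \<in> ?R"
        by (simp add: rim_def insert_commute)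
      moreover have "(rim_vertex n i, n) \<in> ?R\<^sup>*"
        using step by auto
      ultimately show ?case
        by (rule converse_rtrancl_into_rtrancl)
    qed
  qed
qed

lemma verts_leg:
  "v \<in> \<Union>(leg n x d) \<Longrightarrow>
    v = n \<or> (\<exists>y. min x (x + d) \<le> y \<and> y \<le> max x (x + d) \<and> v = rim_vertex n y)"
proof -
  assume "v \<in> \<Union>(leg n x d)"
  then consider "v = n" | "v = rim_vertex n (x + d)"
    | y where "min x (x + d) \<le> y" "y < max x (x + d)" "v = rim_vertex n y \<or> v = rim_vertex n (y + 1)"
    by (auto simp: leg_def spoke_def rim_def)
  then show ?thesis
  proof cases
    case 3
    then have "min x (x + d) \<le> y + 1" "y + 1 \<le> max x (x + d)" "y \<le> max x (x + d)"
      by linarith+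
    with 3 show ?thesis
      by blast
  next
    case 2
    have "min x (x + d) \<le> x + d" "x + d \<le> max x (x + d)"
      by linarith+
    with 2 show ?thesis
      by blast
  qed blast
qed

lemma leg_vertex_reaches_hub:
  assumes "v \<in> \<Union>(leg n x d)" "leg n x d \<subseteq> E"
  shows "(v, n) \<in> {(u, v). {u, v} \<in> E}\<^sup>*"
proof (cases "v = n")
  case False
  then show ?thesis
    using verts_leg[OF assms(1)] leg_reaches_hub[OF _ _ assms(2)] by blast
qed simp

lemma start_in_leg: "rim_vertex n x \<in> \<Union>(leg n x d)"
proof (cases "d = 0")
  case False
  then have "rim n (if d < 0 then x - 1 else x) \<in> leg n x d"
    by (auto simp: leg_def)
  moreover have "rim_vertex n x \<in> rim n (if d < 0 then x - 1 else x)"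
    by (auto simp: rim_def)
  ultimately show ?thesis
    by (rule UnionI)
qed (auto simp: leg_def spoke_def)

text \<open>Every leg is connected to the hub, so a union of legs is connected however they overlap. Sets \<open>S\<close>
containing the hub need no separate condition: the legs for the two rim vertices in \<open>S\<close> and
any third one cover them.\<close>

lemma rainbow_coloring3_wheel_if_legs:
  assumes n: "3 \<le> n"
    and legs: "\<And>x y z. 0 \<le> x \<Longrightarrow> x < y \<Longrightarrow> y < z \<Longrightarrow> z < int n \<Longrightarrow>
      \<exists>d e f. inj_on c (leg n x d \<union> leg n y e \<union> leg n z f)"
  shows "rainbow_coloring3 (wheel n) c"
proof (rule rainbow_coloring3_if_connected_subgraphs)
  fix S :: "nat set" assume S: "S \<subseteq> verts (wheel n)" "card S = 3"
  have "card (S - {n}) \<le> 3"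
    using S(2) card_Diff1_le[of S n] by simp
  moreover have "S - {n} \<subseteq> {..<n}"
    using S(1) unfolding verts_wheel by force
  ultimately obtain T where T: "S - {n} \<subseteq> T" "T \<subseteq> {..<n}" "card T = 3"
    using exists_subset_between[of "S - {n}" 3 "{..<n}"] n by auto
  obtain x y z where xyz: "T = {x, y, z}" "x < y" "y < z"
    using obtain_ordered_triple[OF T(3)] .
  have less: "x < n" "y < n" "z < n"
    using T(2) xyz by auto
  obtain d e f where inj: "inj_on c (leg n (int x) d \<union> leg n (int y) e \<union> leg n (int z) f)"
    using legs[of "int x" "int y" "int z"] xyz less by auto
  define E where "E = leg n (int x) d \<union> leg n (int y) e \<union> leg n (int z) f"
  have E: "E \<subseteq> edges (wheel n)"
    using n by (simp add: E_def leg_in_wheel)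
  let ?H = "\<lparr>verts = \<Union>E, edges = E\<rparr>" and ?R = "{(u, v). {u, v} \<in> E}"
  have "subgraph ?H (wheel n)"
  proof -
    have "\<Union>E \<subseteq> verts (wheel n)"
      using E simple_graph_wheel[OF n] by (auto simp: simple_graph_def)
    moreover from this have "finite (\<Union>E)"
      by (rule finite_subset) (simp add: verts_wheel)
    ultimately show ?thesis
      using E simple_graph_wheel[OF n] by (auto simp: subgraph_def simple_graph_def)
  qed
  moreover have to_hub: "(v, n) \<in> ?R\<^sup>*" if "v \<in> \<Union>E" for v
  proof -
    have "v \<in> \<Union>(leg n (int x) d) \<or> v \<in> \<Union>(leg n (int y) e) \<or> v \<in> \<Union>(leg n (int z) f)"
      using that by (simp add: E_def)
    then show ?thesis
      by (elim disjE; elim leg_vertex_reaches_hub) (auto simp: E_def)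
  qed
  have "connected_graph ?H"
    unfolding connected_graph_def
  proof (intro conjI ballI)
    show "verts ?H \<noteq> {}"
      using start_in_leg[of n "int x" d] by (auto simp: E_def)
    show "(u, v) \<in> {(x, y). {x, y} \<in> edges ?H}\<^sup>*" if "u \<in> verts ?H" "v \<in> verts ?H" for u v
      using to_hub[of u] rtrancl_doubleton_sym[OF to_hub[of v]] that by (auto intro: rtrancl_trans)
  qed
  moreover have "S \<subseteq> \<Union>E"
  proof
    fix v assume "v \<in> S"
    then have "v \<in> {n, x, y, z}"
      using T(1) xyz(1) by auto
    moreover have "n \<in> \<Union>E"
      by (auto simp: E_def leg_def spoke_def)
    moreover have "{x, y, z} \<subseteq> \<Union>E"
      using start_in_leg[of n "int x" d] start_in_leg[of n "int y" e] start_in_leg[of n "int z" f] less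
      by (auto simp: E_def rim_vertex_of_nat)
    ultimately show "v \<in> \<Union>E"
      by auto
  qed
  ultimately show "\<exists>H. subgraph H (wheel n) \<and> connected_graph H \<and> inj_on c (edges H) \<and> S \<subseteq> verts H"
    using inj by (intro exI[of _ ?H]) (auto simp: E_def)
qed

section \<open>Colourings of wheels given by their spokes and rim edges\<close>

text \<open>Colours \<open>s i\<close> for the spoke at \<open>i\<close> and \<open>r i\<close> for the rim edge from \<open>i\<close> to \<open>i + 1\<close>. An edge is a set,
so its index has to be recovered: it is the minimum, except for the rim edge from \<open>n - 1\<close> back to 0.\<close>

definition wheel_coloring :: "nat \<Rightarrow> (nat \<Rightarrow> nat) \<Rightarrow> (nat \<Rightarrow> nat) \<Rightarrow> nat set \<Rightarrow> nat" where
  "wheel_coloring n s r e =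
    (if n \<in> e then s (Min e) else if {0, n - 1} \<subseteq> e then r (n - 1) else r (Min e))"

lemma wheel_coloring_spoke: "0 < n \<Longrightarrow> wheel_coloring n s r (spoke n i) = s (rim_vertex n i)"
  using rim_vertex_less[of n i] by (simp add: wheel_coloring_def spoke_def min_def)

lemma wheel_coloring_rim:
  assumes "3 \<le> n"
  shows "wheel_coloring n s r (rim n i) = r (rim_vertex n i)"
proof -
  define j where "j = rim_vertex n i"
  have j: "j < n"
    using rim_vertex_less[of n i] assms by (simp add: j_def)
  have "rim_vertex n i = rim_vertex n (int j)"
    using rim_vertex_of_nat[OF j] by (simp add: j_def)
  then have "rim_vertex n (i + 1) = rim_vertex n (int j + 1)"
    using rim_vertex_cong_add assms by (metis not_numeral_le_zero gr0I)
  then have "rim n i = {j, Suc j mod n}"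
    using rim_vertex_Suc[OF j] by (simp add: rim_def j_def)
  moreover have "wheel_coloring n s r {j, Suc j mod n} = r j"
    using j assms by (cases "Suc j = n") (auto simp: wheel_coloring_def min_def)
  ultimately show ?thesis
    by (simp add: j_def)
qed

lemma card_colors_le:
  assumes "3 \<le> n" "\<And>i. i < n \<Longrightarrow> s i < k" "\<And>i. i < n \<Longrightarrow> r i < k"
  shows "card (wheel_coloring n s r ` edges (wheel n)) \<le> k"
proof -
  have "wheel_coloring n s r ` edges (wheel n) \<subseteq> {..<k}"
    using assms rim_vertex_less[of n] by (auto simp: edges_wheel wheel_coloring_spoke wheel_coloring_rim)
  then show ?thesis
    using card_mono[of "{..<k}"] by fastforce
qed

section \<open>Checking an explicit colouring\<close>

text \<open>For evaluation the edges are coded by numbers, spokes by \<open>0, \<dots>, n - 1\<close> and rim edges by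
\<open>n, \<dots>, 2 * n - 1\<close>; each code comes with its colour.\<close>

definition colored_leg :: "nat list \<Rightarrow> nat list \<Rightarrow> int \<Rightarrow> int \<Rightarrow> (nat \<times> nat) list" where
  "colored_leg s r x d =
    (let n = length s; y = rim_vertex n (x + d)
     in (y, s ! y) # map (\<lambda>i. let j = rim_vertex n i in (n + j, r ! j)) [min x (x + d)..max x (x + d) - 1])"

definition decode_edge :: "nat \<Rightarrow> nat \<Rightarrow> nat set" where
  "decode_edge n e = (if e < n then spoke n (int e) else rim n (int (e - n)))"

text \<open>The same edge may occur in both legs, but different edges must have different colours.\<close>

definition compatible :: "(nat \<times> nat) list \<Rightarrow> (nat \<times> nat) list \<Rightarrow> bool" where
  "compatible l m \<longleftrightarrow> list_all (\<lambda>(e, a). list_all (\<lambda>(f, b). a = b \<longrightarrow> e = f) m) l"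

fun triples :: "('a \<Rightarrow> 'a \<Rightarrow> 'a \<Rightarrow> bool) \<Rightarrow> 'a list \<Rightarrow> bool" where
  "triples P [] \<longleftrightarrow> True"
| "triples P (x # xs) \<longleftrightarrow> sorted_wrt (P x) xs \<and> triples P xs"

definition joinable :: "(nat \<times> nat) list list \<Rightarrow> (nat \<times> nat) list list \<Rightarrow> (nat \<times> nat) list list \<Rightarrow> bool" where
  "joinable A B C \<longleftrightarrow>
    list_ex (\<lambda>a. list_ex (\<lambda>b. compatible a b \<and> list_ex (\<lambda>c. compatible a c \<and> compatible b c) C) B) A"

text \<open>Legs of at most two rim steps suffice for all explicit colourings below. Legs that are not
rainbow themselves are discarded before the triples are considered.\<close>

definition joinable_legs :: "nat list \<Rightarrow> nat list \<Rightarrow> bool" where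
  "joinable_legs s r \<longleftrightarrow> triples joinable
    (map (\<lambda>x. filter (\<lambda>l. compatible l l) (map (colored_leg s r x) [0, 1, -1, 2, -2])) [0..int (length s) - 1])"

lemma triples_nth:
  "triples P xs \<Longrightarrow> i < j \<Longrightarrow> j < k \<Longrightarrow> k < length xs \<Longrightarrow> P (xs ! i) (xs ! j) (xs ! k)"
proof (induction xs arbitrary: i j k)
  case (Cons x xs)
  obtain j' k' where jk: "j = Suc j'" "k = Suc k'"
    using Cons.prems by (cases j; cases k) auto
  show ?case
  proof (cases i)
    case 0
    then show ?thesis
      using Cons.prems jk by (simp add: sorted_wrt_iff_nth_less)
  next
    case (Suc i')
    then show ?thesis
      using Cons.prems jk Cons.IH[of i' j' k'] by simp
  qed
qed simp

lemma decode_edge_spoke: "0 < n \<Longrightarrow> decode_edge n (rim_vertex n i) = spoke n i"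
  by (simp add: decode_edge_def spoke_def rim_vertex_of_nat rim_vertex_less)

lemma decode_edge_rim:
  assumes "0 < n"
  shows "decode_edge n (n + rim_vertex n i) = rim n i"
proof -
  have "rim_vertex n (int (rim_vertex n i)) = rim_vertex n i"
    using assms by (simp add: rim_vertex_of_nat rim_vertex_less)
  from this rim_vertex_cong_add[OF this assms, of 1] show ?thesis
    by (simp add: decode_edge_def rim_def)
qed

lemma leg_decode:
  assumes "s \<noteq> []"
  shows "leg (length s) x d = decode_edge (length s) ` fst ` set (colored_leg s r x d)"
proof -
  have "{min x (x + d)..max x (x + d) - 1} = {min x (x + d)..<max x (x + d)}"
    by auto
  then show ?thesis
    using assms
    by (simp add: leg_def colored_leg_def Let_def image_image decode_edge_spoke decode_edge_rim)
qed

lemma color_colored_leg: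
  assumes "3 \<le> length s" "(e, a) \<in> set (colored_leg s r x d)"
  shows "wheel_coloring (length s) ((!) s) ((!) r) (decode_edge (length s) e) = a"
proof -
  have "0 < length s"
    using assms(1) by linarith
  then show ?thesis
    using assms
    by (auto simp: colored_leg_def Let_def decode_edge_spoke decode_edge_rim
        wheel_coloring_spoke wheel_coloring_rim simp del: length_greater_0_conv)
qed

lemma compatible_iff: "compatible l m \<longleftrightarrow> (\<forall>(e, a)\<in>set l. \<forall>(f, b)\<in>set m. a = b \<longrightarrow> e = f)"
  by (auto simp: compatible_def list_all_iff)

lemma compatible_sym: "compatible l m \<Longrightarrow> compatible m l"
  unfolding compatible_iff by fastforce

lemma rainbow_coloring3_if_joinable_legs:
  assumes "joinable_legs s r" "3 \<le> length s"
  shows "rainbow_coloring3 (wheel (length s)) (wheel_coloring (length s) ((!) s) ((!) r))"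
proof (rule rainbow_coloring3_wheel_if_legs[OF assms(2)])
  fix x y z :: int
  assume xyz: "0 \<le> x" "x < y" "y < z" "z < int (length s)"
  have s: "s \<noteq> []"
    using assms(2) by auto
  let ?c = "wheel_coloring (length s) ((!) s) ((!) r)" and ?leg = "colored_leg s r"
  define legs where "legs = (\<lambda>x. filter (\<lambda>l. compatible l l) (map (?leg x) [0, 1, -1, 2, -2]))"
  have "joinable (map legs [0..int (length s) - 1] ! nat x) (map legs [0..int (length s) - 1] ! nat y)
      (map legs [0..int (length s) - 1] ! nat z)"
    using xyz by (intro triples_nth[OF assms(1)[unfolded joinable_legs_def, folded legs_def]]) auto
  then have "joinable (legs x) (legs y) (legs z)"
    using xyz by (simp add: nth_map)
  then obtain a b c where abc: "a \<in> set (legs x)" "b \<in> set (legs y)" "c \<in> set (legs z)"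
    and comp: "compatible a b" "compatible a c" "compatible b c"
    unfolding joinable_def list_ex_iff by blast
  have is_leg: "\<exists>d. l = ?leg x d \<and> compatible l l" if "l \<in> set (legs x)" for l x
    using that unfolding legs_def set_filter set_map by blast
  obtain d where d: "a = ?leg x d" "compatible a a"
    using is_leg[OF abc(1)] by blast
  obtain e where e: "b = ?leg y e" "compatible b b"
    using is_leg[OF abc(2)] by blast
  obtain f where f: "c = ?leg z f" "compatible c c"
    using is_leg[OF abc(3)] by blast
  define L where "L = {a, b, c}"
  define P where "P = (\<Union>l\<in>L. set l)"
  have all_comp: "compatible l m" if "l \<in> L" "m \<in> L" for l m
    using that comp comp[THEN compatible_sym] d(2) e(2) f(2) unfolding L_def by blast
  have union: "leg (length s) x d \<union> leg (length s) y e \<union> leg (length s) z f = decode_edge (length s) ` fst ` P"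
    using s by (simp add: image_Un Un_assoc P_def L_def leg_decode[of s _ _ r] d(1) e(1) f(1))
  have determined: "u = v" if "(u, i) \<in> P" "(v, i) \<in> P" for u v i
  proof -
    from that obtain l m where "l \<in> L" "m \<in> L" "(u, i) \<in> set l" "(v, i) \<in> set m"
      unfolding P_def by blast
    then show ?thesis
      using all_comp[of l m] unfolding compatible_iff by fastforce
  qed
  have color: "?c (decode_edge (length s) u) = i" if "(u, i) \<in> P" for u i
    using that color_colored_leg[OF assms(2)] unfolding P_def L_def d(1) e(1) f(1) by blast
  have "inj_on ?c (decode_edge (length s) ` fst ` P)"
  proof (rule inj_onI)
    fix g h
    assume "g \<in> decode_edge (length s) ` fst ` P" "h \<in> decode_edge (length s) ` fst ` P" and eq: "?c g = ?c h"
    then obtain u v i j where "(u, i) \<in> P" "(v, j) \<in> P"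
      and gh: "g = decode_edge (length s) u" "h = decode_edge (length s) v"
      by auto
    then have "u = v"
      using eq color[of u i] color[of v j] determined[of u i v] by simp
    then show "g = h"
      by (simp add: gh)
  qed
  then show "\<exists>d e f. inj_on ?c (leg (length s) x d \<union> leg (length s) y e \<union> leg (length s) z f)"
    using union by metis
qed

definition list_coloring :: "nat \<Rightarrow> nat \<Rightarrow> nat list \<Rightarrow> nat list \<Rightarrow> bool" where
  "list_coloring n k s r \<longleftrightarrow>
    length s = n \<and> length r = n \<and> list_all (\<lambda>q. q < k) s \<and> list_all (\<lambda>q. q < k) r \<and> joinable_legs s r"

lemma list_coloring_rainbow:
  assumes "list_coloring n k s r" "3 \<le> n"
  shows "\<exists>c :: nat set \<Rightarrow> nat. rainbow_coloring3 (wheel n) c \<and> card (c ` edges (wheel n)) \<le> k"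
proof (intro exI conjI)
  have s: "length s = n" "joinable_legs s r"
    using assms(1) by (simp_all add: list_coloring_def)
  show "rainbow_coloring3 (wheel n) (wheel_coloring n ((!) s) ((!) r))"
    using rainbow_coloring3_if_joinable_legs[OF s(2)] s(1) assms(2) by simp
  show "card (wheel_coloring n ((!) s) ((!) r) ` edges (wheel n)) \<le> k"
    using assms by (intro card_colors_le) (auto simp: list_coloring_def list_all_length)
qed

text \<open>The colourings for \<open>n = 6, 8, 12, 16\<close> are symmetric: with \<open>k\<close> colours, the rotation of the rim by
\<open>n div k\<close> positions increases all colours of spokes and rim edges by 1 modulo \<open>k\<close>.\<close>

lemma list_coloring_4: "list_coloring 4 3 [1,0,0,2] [2,1,1,2]" by code_simp
lemma list_coloring_5: "list_coloring 5 3 [1,0,2,2,1] [2,1,0,1,0]" by code_simp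
lemma list_coloring_6: "list_coloring 6 3 [2,1,0,2,1,0] [0,2,1,0,2,1]" by code_simp
lemma list_coloring_7: "list_coloring 7 4 [2,2,0,1,0,1,3] [3,1,0,3,2,0,3]" by code_simp
lemma list_coloring_8: "list_coloring 8 4 [2,1,3,2,0,3,1,0] [3,2,0,3,1,0,2,1]" by code_simp
lemma list_coloring_9: "list_coloring 9 4 [3,0,2,0,1,1,2,2,3] [3,3,1,3,3,0,3,0,1]" by code_simp
lemma list_coloring_10: "list_coloring 10 4 [2,1,1,2,0,0,3,3,1,3] [0,2,3,3,1,2,0,2,0,1]" by code_simp
lemma list_coloring_11: "list_coloring 11 4 [3,2,3,2,1,3,2,3,1,0,0] [1,0,1,0,2,0,1,0,1,3,2]" by code_simp
lemma list_coloring_12: "list_coloring 12 4 [3,3,1,0,0,2,1,1,3,2,2,0] [2,0,2,3,1,3,0,2,0,1,3,1]" by code_simp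
lemma list_coloring_13: "list_coloring 13 4 [3,1,1,3,0,3,1,1,2,0,2,0,2] [0,2,0,2,1,2,0,3,3,1,3,1,1]" by code_simp
lemma list_coloring_14: "list_coloring 14 4 [3,2,3,2,3,3,0,0,1,0,1,1,2,2] [0,1,0,1,0,1,3,2,3,2,3,0,0,1]" by code_simp
lemma list_coloring_15:
  "list_coloring 15 4 [0,3,1,3,1,3,2,3,2,0,2,1,2,1,0] [1,0,2,0,2,0,1,0,1,3,0,3,0,3,2]" by code_simp
lemma list_coloring_16:
  "list_coloring 16 4 [3,2,0,3, 0,3,1,0, 1,0,2,1, 2,1,3,2] [1,3,2,1, 2,0,3,2, 3,1,0,3, 0,2,1,0]" by code_simp

section \<open>Two colours on the wheel with three rim vertices\<close>

lemma rainbow_subgraph_two_edges: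
  assumes G: "simple_graph G" and e: "{u, v} \<in> edges G" "{v, w} \<in> edges G" "c {u, v} \<noteq> c {v, w}"
  shows "\<exists>H. subgraph H G \<and> connected_graph H \<and> inj_on c (edges H) \<and> {u, v, w} \<subseteq> verts H"
proof (intro exI conjI)
  let ?H = "\<lparr>verts = {u, v, w}, edges = {{u, v}, {v, w}}\<rparr>" and ?R = "{(x, y). {x, y} \<in> {{u, v}, {v, w}}}"
  show "subgraph ?H G"
    using G e(1,2) by (auto simp: subgraph_def simple_graph_def)
  have "(x, v) \<in> ?R\<^sup>*" if "x \<in> {u, v, w}" for x
    using that by (auto simp: insert_commute)
  then show "connected_graph ?H"
    unfolding connected_graph_def using rtrancl_doubleton_sym by (auto intro: rtrancl_trans)
  show "inj_on c (edges ?H)"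
    using e(3) by auto
qed simp

text \<open>The wheel is the complete graph on four vertices. It suffices that no triangle is monochromatic, and
colour 1 is given to the path 2, 0, 1, 3 and colour 0 to its complement, which is also a path.\<close>

lemma wheel_3_coloring:
  obtains c :: "nat set \<Rightarrow> nat" where "rainbow_coloring3 (wheel 3) c" "card (c ` edges (wheel 3)) \<le> 2"
proof -
  define c :: "nat set \<Rightarrow> nat" where "c e = (if e \<in> {{0, 1}, {0, 2}, {1, 3}} then 1 else 0)" for e
  have E: "{0, 1} \<in> edges (wheel 3)" "{0, 2} \<in> edges (wheel 3)" "{1, 2} \<in> edges (wheel 3)"
    "{0, 3} \<in> edges (wheel 3)" "{1, 3} \<in> edges (wheel 3)" "{2, 3} \<in> edges (wheel 3)"
    using rim_in_wheel[of 3 0] rim_in_wheel[of 3 1] rim_in_wheel[of 3 2]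
      spoke_in_wheel[of 3 0] spoke_in_wheel[of 3 1] spoke_in_wheel[of 3 2]
    by (simp_all add: rim_def spoke_def rim_vertex_def insert_commute)
  have path: "\<exists>H. subgraph H (wheel 3) \<and> connected_graph H \<and> inj_on c (edges H) \<and> S \<subseteq> verts H"
    if "S = {u, v, w}" "{u, v} \<in> edges (wheel 3)" "{v, w} \<in> edges (wheel 3)" "c {u, v} \<noteq> c {v, w}" for S u v w
    unfolding that(1) by (rule rainbow_subgraph_two_edges[OF simple_graph_wheel that(2-4)]) simp
  have "rainbow_coloring3 (wheel 3) c"
  proof (rule rainbow_coloring3_if_connected_subgraphs)
    fix S assume S: "S \<subseteq> verts (wheel 3)" "card S = 3"
    obtain x y z where xyz: "S = {x, y, z}" "x < y" "y < z"
      using obtain_ordered_triple[OF S(2)] .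
    have "z \<le> 3"
      using S(1) xyz(1) by (simp add: verts_wheel)
    with xyz(2,3) have "x = 0 \<and> y = 1 \<and> z = 2 \<or> x = 0 \<and> y = 1 \<and> z = 3 \<or> x = 0 \<and> y = 2 \<and> z = 3 \<or> x = 1 \<and> y = 2 \<and> z = 3"
      by presburger
    then consider "S = {0, 1, 2}" | "S = {1, 0, 3}" | "S = {2, 0, 3}" | "S = {1, 3, 2}"
      unfolding xyz(1) by (elim disjE conjE) (simp_all add: insert_commute)
    then show "\<exists>H. subgraph H (wheel 3) \<and> connected_graph H \<and> inj_on c (edges H) \<and> S \<subseteq> verts H"
      by cases (erule path; use E in \<open>simp add: c_def doubleton_eq_iff insert_commute\<close>)+
  qed
  moreover have "card (c ` edges (wheel 3)) \<le> card {0, 1 :: nat}"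
    by (intro card_mono) (auto simp: c_def)
  ultimately show thesis
    using that by simp
qed

section \<open>Five colours on every wheel\<close>

text \<open>The colours 0, 1, 2 repeat up to the last multiple of 3; at most two spokes are left over and get
the colours 3 and 4, which occur on no other spoke.\<close>

definition five_spokes :: "nat \<Rightarrow> nat \<Rightarrow> nat" where
  "five_spokes n i = (let m = 3 * (n div 3) in if i < m then i mod 3 else 3 + (i - m))"

definition five_rims :: "nat \<Rightarrow> nat" where
  "five_rims i = 3 + i mod 2"

definition joined_by_legs :: "nat \<Rightarrow> (nat set \<Rightarrow> nat) \<Rightarrow> nat \<Rightarrow> nat \<Rightarrow> nat \<Rightarrow> bool" where
  "joined_by_legs n c x y z \<longleftrightarrow> (\<exists>d e f. inj_on c (leg n (int x) d \<union> leg n (int y) e \<union> leg n (int z) f))"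

lemma joined_by_legs_commute: "joined_by_legs n c x y z \<Longrightarrow> joined_by_legs n c y x z"
  unfolding joined_by_legs_def by (metis Un_commute)

lemma joined_by_legs_rotate: "joined_by_legs n c x y z \<Longrightarrow> joined_by_legs n c y z x"
  unfolding joined_by_legs_def by (metis Un_commute Un_assoc)

lemma joined_by_legsI:
  assumes "leg n (int x) d \<union> leg n (int y) e \<union> leg n (int z) f \<subseteq> set es" "distinct (map c es)"
  shows "joined_by_legs n c x y z"
  using assms inj_on_subset[of c "set es"] unfolding joined_by_legs_def distinct_map by blast

lemma leg_direct: "leg n x 0 = {spoke n x}"
  by (simp add: leg_def)

lemma leg_up: "leg n (int i) 1 = {spoke n (int (Suc i)), rim n (int i)}"
proof -
  have "{int i..<int i + 1} = {int i}"
    by auto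
  then show ?thesis
    by (simp add: leg_def add.commute)
qed

lemma leg_down: "leg n (int (Suc i)) (-1) = {spoke n (int i), rim n (int i)}"
proof -
  have "{int i..<1 + int i} = {int i}"
    by auto
  then show ?thesis
    by (simp add: leg_def)
qed

context
  fixes n :: nat and c
  assumes n: "3 \<le> n" and c: "c = wheel_coloring n (five_spokes n) five_rims"
begin

lemma color_spoke: "i < n \<Longrightarrow> c (spoke n (int i)) = five_spokes n i"
  using n by (simp add: c wheel_coloring_spoke rim_vertex_of_nat)

lemma color_rim: "i < n \<Longrightarrow> c (rim n (int i)) = five_rims i"
  using n by (simp add: c wheel_coloring_rim rim_vertex_of_nat)

lemma five_spokes_less: "i < n \<Longrightarrow> five_spokes n i < 5"
  by (auto simp: five_spokes_def Let_def)

lemma equal_five_spokes: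
  assumes "x < n" "y < n" "x \<noteq> y" "five_spokes n x = five_spokes n y"
  shows "x < 3 * (n div 3) \<and> y < 3 * (n div 3) \<and> x mod 3 = y mod 3"
  using assms by (auto simp: five_spokes_def Let_def split: if_splits)

lemma five_spokes_mod: "i < 3 * (n div 3) \<Longrightarrow> five_spokes n i = i mod 3"
  by (simp add: five_spokes_def Let_def)

lemma Suc_mod_3_neq: "Suc i mod 3 \<noteq> i mod 3" "Suc (Suc i) mod 3 \<noteq> i mod 3"
  by presburger+

lemma Suc_neq_3_mult: "y mod 3 = 0 \<Longrightarrow> Suc y \<noteq> 3 * q" for q y :: nat
  by presburger

text \<open>Of two equally coloured spokes at most one is next to the seam of the repeating pattern, since the two
positions at the seam have the colours 0 and 2. The other one has neighbours with both remaining
colours among 0, 1, 2, reached by rim edges of both colours 3 and 4. So either the neighbouring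
spoke can be chosen to avoid a third colour below 3, or the rim edge to avoid a third colour
from 3 on.\<close>

lemma joined_by_legs_two_equal:
  assumes "x < n" "y < n" "z < n" "x \<noteq> y"
    and eq: "five_spokes n x = five_spokes n y" and neq: "five_spokes n z \<noteq> five_spokes n x"
  shows "joined_by_legs n c x y z"
proof -
  let ?m = "3 * (n div 3)"
  have m: "?m \<le> n"
    by simp
  have *: "joined_by_legs n c x y z"
    if x: "0 < x" "Suc x < ?m" and y: "y < n" "five_spokes n y = five_spokes n x"
      and neq: "five_spokes n z \<noteq> five_spokes n x" for x y
  proof -
    obtain i where i: "x = Suc i"
      using x(1) by (cases x) auto
    have less: "i < n" "Suc i < n" "Suc (Suc i) < n" "i < ?m" "Suc i < ?m" "Suc (Suc i) < ?m"
      using x(2) m i by linarith+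
    have neq': "five_spokes n z \<noteq> five_spokes n (Suc i)"
      using neq i by simp
    have "five_spokes n i \<noteq> five_spokes n (Suc i)" "five_spokes n (Suc (Suc i)) \<noteq> five_spokes n (Suc i)"
      "five_spokes n i \<noteq> five_spokes n (Suc (Suc i))"
      "five_spokes n i < 3" "five_spokes n (Suc i) < 3" "five_spokes n (Suc (Suc i)) < 3"
      unfolding less(4-6)[THEN five_spokes_mod] by presburger+
    moreover have "five_rims i \<noteq> five_rims (Suc i)" "3 \<le> five_rims i" "3 \<le> five_rims (Suc i)"
      unfolding five_rims_def by presburger+
    ultimately consider
        "five_spokes n i \<notin> {five_spokes n z, five_spokes n x}" "five_rims i \<notin> {five_spokes n z, five_spokes n x, five_spokes n i}"
      | "five_spokes n (Suc x) \<notin> {five_spokes n z, five_spokes n x}" "five_rims x \<notin> {five_spokes n z, five_spokes n x, five_spokes n (Suc x)}"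
      using neq' unfolding i by fastforce
    then show ?thesis
    proof cases
      case 1
      then show ?thesis
        using less y neq' \<open>z < n\<close> unfolding i
        by (intro joined_by_legsI[where d = "-1" and e = 0 and f = 0
              and es = "[spoke n (int y), spoke n (int z), spoke n (int i), rim n (int i)]"])
          (auto simp: leg_down leg_direct color_spoke color_rim simp del: of_nat_Suc)
    next
      case 2
      then show ?thesis
        using less y neq' \<open>z < n\<close> unfolding i
        by (intro joined_by_legsI[where d = 1 and e = 0 and f = 0
              and es = "[spoke n (int y), spoke n (int z), spoke n (int (Suc (Suc i))), rim n (int (Suc i))]"])
          (auto simp: leg_up leg_direct color_spoke color_rim simp del: of_nat_Suc)
    qed
  qed
  have less: "x < ?m" "y < ?m" and mod: "x mod 3 = y mod 3"
    using equal_five_spokes[OF assms(1,2,4) eq] by auto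
  have apart: "\<not> (x = 0 \<and> Suc y = 3 * q)" "\<not> (y = 0 \<and> Suc x = 3 * q)" for q
    using mod Suc_neq_3_mult[of y q] Suc_neq_3_mult[of x q] by auto
  have "0 < x \<and> Suc x < ?m \<or> 0 < y \<and> Suc y < ?m"
  proof (cases "x = 0 \<or> Suc x = ?m")
    case True
    then have "0 < y" "Suc y \<noteq> ?m"
      using \<open>x \<noteq> y\<close> apart[of "n div 3"] by (cases "x = 0"; cases "y = 0"; simp)+
    then show ?thesis
      using less by linarith
  next
    case False
    then show ?thesis
      using less by linarith
  qed
  then show ?thesis
  proof
    assume "0 < x \<and> Suc x < ?m"
    then show ?thesis
      using *[of x y] assms by simp
  next
    assume "0 < y \<and> Suc y < ?m"
    then have "joined_by_legs n c y x z"
      using *[of y x] assms by simp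
    then show ?thesis
      by (rule joined_by_legs_commute)
  qed
qed

text \<open>The smaller vertex \<open>x\<close> moves up and the larger vertex \<open>y\<close> moves down, so that neither crosses the
seam and their new spokes have different colours. The rim edges used start at \<open>x\<close> and \<open>y - 1\<close>; they
have different colours because \<open>x\<close> and \<open>y\<close> have the same parity.\<close>

lemma joined_by_legs_all_equal:
  assumes "x < y" "y < n" "z < n" "x \<noteq> z" "y \<noteq> z" "even x = even y"
    and eq: "five_spokes n x = five_spokes n z" "five_spokes n y = five_spokes n z"
  shows "joined_by_legs n c x y z"
proof -
  let ?m = "3 * (n div 3)"
  obtain j where j: "y = Suc j"
    using assms(1) by (cases y) auto
  have "x < n"
    using assms(1,2) by linarith
  from equal_five_spokes[OF this assms(3,4) eq(1)] equal_five_spokes[OF assms(2,3,5) eq(2)]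
  have less: "x < ?m" "y < ?m" "z < ?m" and mod: "x mod 3 = z mod 3" "y mod 3 = z mod 3"
    by blast+
  have s: "five_spokes n z < 3" "five_spokes n (Suc x) < 3" "five_spokes n j < 3"
    "distinct [five_spokes n z, five_spokes n (Suc x), five_spokes n j]"
  proof -
    have "Suc x < ?m" "j < ?m"
      using less assms(1) j by linarith+
    note s = this[THEN five_spokes_mod] less(3)[THEN five_spokes_mod]
    have "j mod 3 \<noteq> z mod 3" "Suc x mod 3 \<noteq> z mod 3" "j mod 3 \<noteq> Suc x mod 3"
    proof -
      have "Suc j mod 3 = x mod 3"
        using mod unfolding j by simp
      then have "Suc (Suc j) mod 3 = Suc x mod 3"
        by (metis mod_Suc)
      then show "j mod 3 \<noteq> z mod 3" "Suc x mod 3 \<noteq> z mod 3" "j mod 3 \<noteq> Suc x mod 3"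
        using mod Suc_mod_3_neq[of j] Suc_mod_3_neq(1)[of x] unfolding j by metis+
    qed
    then show "five_spokes n z < 3" "five_spokes n (Suc x) < 3" "five_spokes n j < 3"
        "distinct [five_spokes n z, five_spokes n (Suc x), five_spokes n j]"
      unfolding s by auto
  qed
  have r: "3 \<le> five_rims x" "3 \<le> five_rims j" "five_rims x \<noteq> five_rims j"
    using assms(6) unfolding j by (simp_all add: five_rims_def mod2_eq_if)
  have "distinct [five_spokes n z, five_spokes n (Suc x), five_rims x, five_spokes n j, five_rims j]"
    using s r by auto
  moreover have "Suc x < n" "j < n"
    using assms(1,2) j by linarith+
  ultimately show ?thesis
    using \<open>x < n\<close> \<open>z < n\<close> unfolding j
    by (intro joined_by_legsI[where d = 1 and e = "-1" and f = 0 and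
          es = "[spoke n (int z), spoke n (int (Suc x)), rim n (int x), spoke n (int j), rim n (int j)]"])
      (auto simp: leg_up leg_down leg_direct color_spoke color_rim simp del: of_nat_Suc)
qed

lemma joined_by_legs_all_different:
  assumes "x < n" "y < n" "z < n" "distinct [five_spokes n x, five_spokes n y, five_spokes n z]"
  shows "joined_by_legs n c x y z"
  using assms
  by (intro joined_by_legsI[where d = 0 and e = 0 and f = 0 and
        es = "[spoke n (int x), spoke n (int y), spoke n (int z)]"])
    (auto simp: leg_direct color_spoke)

lemma three_values_cases:
  "distinct [p, q, r] \<or> p = q \<and> r \<noteq> p \<or> q = r \<and> p \<noteq> q \<or> r = p \<and> q \<noteq> r \<or> p = q \<and> q = r \<and> p = r"
  by auto

text \<open>If all three colours are equal, two of the three vertices have the same parity and are the ones to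
be moved.\<close>

lemma five_coloring_rainbow: "rainbow_coloring3 (wheel n) c"
proof -
  have "3 \<le> n"
    using n by simp
  then show ?thesis
  proof (rule rainbow_coloring3_wheel_if_legs)
  fix x' y' z' :: int
  assume *: "0 \<le> x'" "x' < y'" "y' < z'" "z' < int n"
  define x y z where xyz_def: "x = nat x'" "y = nat y'" "z = nat z'"
  have xyz: "x' = int x" "y' = int y" "z' = int z" "x < y" "y < z" "z < n" "x < n" "y < n"
    unfolding xyz_def using * by simp_all
  let ?s = "five_spokes n"
  have "joined_by_legs n c x y z"
  proof (cases "distinct [?s x, ?s y, ?s z]")
    case True
    then show ?thesis
      by (rule joined_by_legs_all_different[OF xyz(7,8,6)])
  next
    case False
    then consider "?s x = ?s y" "?s z \<noteq> ?s x" | "?s y = ?s z" "?s x \<noteq> ?s y"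
      | "?s z = ?s x" "?s y \<noteq> ?s z" | "?s x = ?s y" "?s y = ?s z" "?s x = ?s z"
      using three_values_cases[of "?s x" "?s y" "?s z"] by blast
    then show ?thesis
    proof cases
      case 1
      show ?thesis
        by (rule joined_by_legs_two_equal[OF xyz(7,8,6) _ 1]) (use xyz(4) in simp)
    next
      case 2
      have "joined_by_legs n c y z x"
        by (rule joined_by_legs_two_equal[OF xyz(8,6,7) _ 2]) (use xyz(5) in simp)
      then show ?thesis
        by (rule joined_by_legs_rotate[OF joined_by_legs_rotate])
    next
      case 3
      have "joined_by_legs n c z x y"
        by (rule joined_by_legs_two_equal[OF xyz(6,7,8) _ 3]) (use xyz(4,5) in simp)
      then show ?thesis
        by (rule joined_by_legs_rotate)
    next
      case 4
      have neq: "x \<noteq> y" "x \<noteq> z" "y \<noteq> z" "x < z"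
        using xyz(4,5) by simp_all
      consider "even x = even y" | "even y = even z" | "even x = even z"
        by blast
      then show ?thesis
      proof cases
        case 1
        show ?thesis
          by (rule joined_by_legs_all_equal[OF xyz(4,8,6) neq(2,3) 1 4(3,2)])
      next
        case 2
        have "joined_by_legs n c y z x"
          by (rule joined_by_legs_all_equal[OF xyz(5,6,7) neq(1,2)[symmetric] 2 4(1,3)[symmetric]])
        then show ?thesis
          by (rule joined_by_legs_rotate[OF joined_by_legs_rotate])
      next
        case 3
        have "joined_by_legs n c x z y"
          by (rule joined_by_legs_all_equal[OF neq(4) xyz(6,8) neq(1) neq(3)[symmetric] 3 4(1) 4(2)[symmetric]])
        then show ?thesis
          by (rule joined_by_legs_commute[OF joined_by_legs_rotate[OF joined_by_legs_rotate]])
      qed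
    qed
  qed
  then show "\<exists>d e f. inj_on c (leg n x' d \<union> leg n y' e \<union> leg n z' f)"
    unfolding joined_by_legs_def xyz(1-3) .
  qed
qed

lemma five_coloring_card: "card (c ` edges (wheel n)) \<le> 5"
  unfolding c using n five_spokes_less by (intro card_colors_le) (auto simp: five_rims_def)

end

section \<open>Connected rainbow subgraphs with few vertices\<close>

lemma singleton_psubset: "u \<in> S \<Longrightarrow> w \<in> S \<Longrightarrow> u \<noteq> w \<Longrightarrow> {u} \<subset> S"
  by blast

lemma spoke_eq_iff: "0 < n \<Longrightarrow> spoke n i = spoke n j \<longleftrightarrow> rim_vertex n i = rim_vertex n j"
  using rim_vertex_less[of n i] rim_vertex_less[of n j] by (auto simp: spoke_def doubleton_eq_iff)

text \<open>The vertices \<open>V\<close> and edges \<open>E\<close> of a rainbow tree for \<open>S\<close> in the wheel. Connectedness is recorded in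
the form in which it is used: some edge leaves each proper nonempty part of \<open>V\<close>.\<close>

definition connector :: "nat \<Rightarrow> (nat set \<Rightarrow> nat) \<Rightarrow> nat set \<Rightarrow> nat set \<Rightarrow> nat set set \<Rightarrow> bool" where
  "connector n c S V E \<longleftrightarrow> S \<subseteq> V \<and> V \<subseteq> {..n} \<and> E \<subseteq> edges (wheel n) \<and> inj_on c E \<and>
    (\<forall>U. U \<subset> V \<longrightarrow> U \<noteq> {} \<longrightarrow> (\<exists>u\<in>U. \<exists>v\<in>V - U. {u, v} \<in> E))"

lemma obtain_connector:
  assumes "3 \<le> n" "rainbow_coloring3 (wheel n) c" "card (c ` edges (wheel n)) \<le> k"
    and S: "S \<subseteq> {..n}" "card S = 3"
  obtains V E where "connector n c S V E" "card V \<le> k + 1"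
proof -
  obtain T where T: "rainbow_S_tree (wheel n) c S T"
    using assms unfolding rainbow_coloring3_def verts_wheel by blast
  then have sub: "subgraph T (wheel n)" "inj_on c (edges T)" "S \<subseteq> verts T"
    and tree: "simple_graph T" "connected_graph T"
    by (auto simp: rainbow_S_tree_def rainbow_tree_def is_tree_def)
  have "finite (edges (wheel n))"
    by (simp add: edges_wheel)
  then have "card (c ` edges T) \<le> card (c ` edges (wheel n))"
    using sub(1) unfolding subgraph_def by (intro card_mono finite_imageI image_mono) auto
  then have "card (edges T) \<le> k"
    using card_image[OF sub(2)] assms(3) by linarith
  then have "card (verts T) \<le> k + 1"
    using connected_graph_card_verts_le[OF tree] by linarith
  moreover have "connector n c S (verts T) (edges T)"
    using sub connected_graph_cut[OF tree] unfolding connector_def subgraph_def verts_wheel by blast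
  ultimately show thesis
    using that by blast
qed

lemma connector_cut:
  assumes "connector n c S V E" "U \<subset> V" "U \<noteq> {}"
  obtains u v where "u \<in> U" "v \<in> V - U" "{u, v} \<in> E"
proof -
  have "\<exists>u\<in>U. \<exists>v\<in>V - U. {u, v} \<in> E"
    using assms by (simp add: connector_def)
  then show thesis
    using that by blast
qed

lemma connector_neighbour:
  assumes "connector n c S V E" "0 < n" "{rim_vertex n i, v} \<in> E"
  shows "v = n \<or> v = rim_vertex n (i + 1) \<or> v = rim_vertex n (i - 1)"
proof (rule wheel_neighbours[OF assms(2)])
  show "{rim_vertex n i, v} \<in> edges (wheel n)"
    using assms(1,3) by (auto simp: connector_def)
qed

lemma connector_inj:
  "connector n c S V E \<Longrightarrow> e \<in> E \<Longrightarrow> f \<in> E \<Longrightarrow> c e = c f \<Longrightarrow> e = f"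
  unfolding connector_def inj_on_def by blast

text \<open>Without the hub, a maximal run of consecutive rim vertices in \<open>V\<close> cannot be left.\<close>

lemma connector_without_hub_in_window:
  assumes conn: "connector n c S V E" and "n \<notin> V" "V \<noteq> {}" "card V < n"
  obtains x where "\<And>v. v \<in> V \<Longrightarrow> \<exists>i. 0 \<le> i \<and> i < int (card V) \<and> v = rim_vertex n (x + i)"
proof -
  have n: "0 < n"
    using assms(4) by simp
  have V: "V \<subseteq> {..<n}"
  proof
    fix v assume "v \<in> V"
    then have "v \<le> n" "v \<noteq> n"
      using conn assms(2) by (auto simp: connector_def)
    then show "v \<in> {..<n}"
      by simp
  qed
  have "\<exists>x. rim_vertex n x \<in> V \<and> rim_vertex n (x - 1) \<notin> V"
  proof (rule ccontr)
    assume *: "\<not> ?thesis"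
    obtain v where "v \<in> V"
      using assms(3) by blast
    moreover from this V obtain i where "v = rim_vertex n i" "0 \<le> i"
      using obtain_rim_vertex[of v n] by blast
    ultimately have i: "rim_vertex n i \<in> V" "0 \<le> i"
      by simp_all
    have "\<not> {..<n} \<subseteq> V"
      using assms(4) card_mono[of V "{..<n}"] finite_subset[OF V] by auto
    then obtain w where "w < n" "w \<notin> V"
      by blast
    moreover from this obtain j where "w = rim_vertex n j" "j < int n"
      using obtain_rim_vertex[of w n] by blast
    ultimately have j: "rim_vertex n j \<notin> V" "j < int n"
      by simp_all
    have "rim_vertex n y \<notin> V" if "j \<le> y" for y
      using that
    proof (induction rule: int_ge_induct)
      case (step y)
      then show ?case
        using *[unfolded not_ex, THEN spec[of _ "y + 1"]] by simp
    qed (rule j(1))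
    from this[of "i + int n"] show False
      using i j(2) by (simp add: rim_vertex_add_period)
  qed
  then obtain x where x: "rim_vertex n x \<in> V" "rim_vertex n (x - 1) \<notin> V"
    by blast
  have outside: "rim_vertex n (x + int (n - 1)) \<notin> V"
    using x(2) rim_vertex_add_period[of n "x - 1"] n by (simp add: of_nat_diff algebra_simps)
  \<comment> \<open>The run of tree vertices that starts at \<open>x\<close> ends at the latest before \<open>x - 1\<close>.\<close>
  define m where "m = (LEAST i. rim_vertex n (x + int i) \<notin> V)"
  have m: "rim_vertex n (x + int m) \<notin> V"
    unfolding m_def using outside by (rule LeastI)
  have m_le: "m \<le> n - 1"
    unfolding m_def using outside by (rule Least_le)
  have least: "rim_vertex n (x + int i) \<in> V" if "i < m" for i
    using not_less_Least[OF that[unfolded m_def]] by simp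
  define U where "U = (\<lambda>i. rim_vertex n (x + int i)) ` {..<m}"
  have U: "U \<subseteq> V" "U \<noteq> {}"
    using least x(1) m by (cases "m = 0"; auto simp: U_def)+
  have "U = V"
  proof (rule ccontr)
    assume "U \<noteq> V"
    then obtain u v where uv: "u \<in> U" "v \<in> V - U" "{u, v} \<in> E"
      using connector_cut[OF conn, of U] U by blast
    then obtain i where i: "i < m" "u = rim_vertex n (x + int i)"
      by (auto simp: U_def)
    have "v \<noteq> n"
      using uv(2) assms(2) by auto
    then consider "v = rim_vertex n (x + int (i + 1))" | "v = rim_vertex n (x + int i - 1)"
      using connector_neighbour[OF conn n, of "x + int i" v] uv(3) i(2) by (auto simp: algebra_simps)
    then show False
    proof cases
      case 1
      then show ?thesis
        using i(1) m uv(2) imageI[of "i + 1" "{..<m}" "\<lambda>i. rim_vertex n (x + int i)"]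
        by (cases "i + 1 = m") (auto simp: U_def)
    next
      case 2
      show ?thesis
      proof (cases i)
        case 0
        then show ?thesis
          using 2 x(2) uv(2) by simp
      next
        case (Suc i')
        then have "v = rim_vertex n (x + int i')" "i' < m"
          using 2 i(1) by auto
        then show ?thesis
          using uv(2) by (auto simp: U_def)
      qed
    qed
  qed
  moreover have "card U = m"
    unfolding U_def using m_le n
    by (subst card_image) (auto simp: inj_on_def rim_vertex_eq_iff)
  ultimately have card: "card V = m"
    by simp
  have "\<exists>i. 0 \<le> i \<and> i < int (card V) \<and> v = rim_vertex n (x + i)" if "v \<in> V" for v
  proof -
    from that obtain i where "i < m" "v = rim_vertex n (x + int i)"
      unfolding \<open>U = V\<close>[symmetric] U_def by blast
    then show ?thesis
      using card by (intro exI[of _ "int i"]) simp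
  qed
  then show thesis
    using that by blast
qed

text \<open>Two positions in a window of at most \<open>n\<close> vertices are joined by one of their two arcs inside
the window.\<close>

lemma window_offset_diff:
  assumes "rim_vertex n a = rim_vertex n (x + i)" "rim_vertex n b = rim_vertex n (x + j)"
    and "a < b" "b < a + int n" "0 \<le> i" "i < int n" "0 \<le> j" "j < int n"
  shows "j - i = b - a \<or> j - i = b - a - int n"
proof -
  have n: "0 < n"
    using assms(3,4) by simp
  have "int n dvd (b - (x + j)) - (a - (x + i))"
    using assms(1,2) n by (simp only: rim_vertex_eq_iff_dvd dvd_diff)
  then obtain q where "(b - (x + j)) - (a - (x + i)) = int n * q"
    by (rule dvdE)
  then have q: "(b - a) - (j - i) = int n * q"
    by simp
  have "int n * (-1) < int n * q" "int n * q < int n * 2"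
    unfolding q[symmetric] using assms by linarith+
  moreover have "0 < int n"
    using n by simp
  ultimately have "-1 < q" "q < 2"
    by (simp_all only: mult_less_cancel_left_pos)
  then have "q = 0 \<or> q = 1"
    by linarith
  then show ?thesis
    using q by auto
qed

text \<open>A window containing all three vertices contains all but one of the three arcs between them. So if
any two of the arcs have total length at least \<open>m\<close>, then \<open>m\<close> vertices are too few without the hub.\<close>

lemma hub_in_connector:
  assumes conn: "connector n c {rim_vertex n a, rim_vertex n b, rim_vertex n d} V E"
    and card: "card V \<le> m" "m < n"
    and order: "a < b" "b < d" "d < a + int n"
    and wide: "int m \<le> d - a" "int m \<le> a + int n - b" "int m \<le> b + int n - d"
  shows "n \<in> V"
proof (rule ccontr)
  assume "n \<notin> V"
  have V: "rim_vertex n a \<in> V" "rim_vertex n b \<in> V" "rim_vertex n d \<in> V"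
    using conn by (auto simp: connector_def)
  then have "V \<noteq> {}" "card V < n"
    using card by auto
  from connector_without_hub_in_window[OF conn \<open>n \<notin> V\<close> this]
  obtain x where x: "\<And>v. v \<in> V \<Longrightarrow> \<exists>i. 0 \<le> i \<and> i < int (card V) \<and> v = rim_vertex n (x + i)"
    by blast
  obtain i where i: "0 \<le> i" "i < int m" "rim_vertex n a = rim_vertex n (x + i)"
    using x[OF V(1)] card(1) by fastforce
  obtain j where j: "0 \<le> j" "j < int m" "rim_vertex n b = rim_vertex n (x + j)"
    using x[OF V(2)] card(1) by fastforce
  obtain l where l: "0 \<le> l" "l < int m" "rim_vertex n d = rim_vertex n (x + l)"
    using x[OF V(3)] card(1) by fastforce
  have "j - i = b - a \<or> j - i = b - a - int n"
    by (rule window_offset_diff[OF i(3) j(3)]) (use order i j card in linarith)+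
  moreover have "l - j = d - b \<or> l - j = d - b - int n"
    by (rule window_offset_diff[OF j(3) l(3)]) (use order j l card in linarith)+
  ultimately show False
    using wide i j l by linarith
qed

lemma card_le_Suc_obtain_extra:
  assumes "finite V" "A \<subseteq> V" "card V \<le> Suc (card A)"
  obtains w where "V \<subseteq> insert w A"
proof -
  have "card (V - A) \<le> Suc 0"
    using assms by (simp add: card_Diff_subset finite_subset[of A V])
  then show thesis
    using that assms(1) card_le_Suc0_iff_eq[of "V - A"] by blast
qed

locale few_colors =
  fixes n k :: nat and c :: "nat set \<Rightarrow> nat"
  assumes rainbow: "rainbow_coloring3 (wheel n) c"
    and few: "card (c ` edges (wheel n)) \<le> k"
    and n_ge_3: "3 \<le> n"
begin

lemma n_pos: "0 < n"
  using n_ge_3 by linarith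

lemma rim_triple_connector:
  assumes "a < b" "b < d" "d < a + int n"
  obtains V E where "connector n c {rim_vertex n a, rim_vertex n b, rim_vertex n d} V E" "card V \<le> k + 1"
proof -
  have "rim_vertex n a \<noteq> rim_vertex n b" "rim_vertex n a \<noteq> rim_vertex n d" "rim_vertex n b \<noteq> rim_vertex n d"
    using assms n_pos by (simp_all add: rim_vertex_eq_iff)
  then have "card {rim_vertex n a, rim_vertex n b, rim_vertex n d} = 3"
    by simp
  moreover have "{rim_vertex n a, rim_vertex n b, rim_vertex n d} \<subseteq> {..n}"
    using rim_vertex_less[OF n_pos] by (auto intro: less_imp_le)
  ultimately show thesis
    using obtain_connector[OF n_ge_3 rainbow few] that by metis
qed

lemma equal_spokes_of_connector:
  assumes "connector n c S V E" "spoke n i \<in> E" "spoke n j \<in> E" "c (spoke n i) = c (spoke n j)"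
  shows "rim_vertex n i = rim_vertex n j"
  using connector_inj[OF assms] n_pos by (simp add: spoke_eq_iff)

text \<open>The pigeonhole principle, with the positions of the equally coloured spokes in increasing order.\<close>

lemma obtain_equal_spokes:
  assumes "m * k < n"
  obtains xs where "length xs = Suc m" "sorted_wrt (<) xs" "set xs \<subseteq> {0..<int n}"
    "\<And>x y. x \<in> set xs \<Longrightarrow> y \<in> set xs \<Longrightarrow> c (spoke n x) = c (spoke n y)"
proof -
  let ?f = "\<lambda>i. c (spoke n i)" and ?B = "c ` edges (wheel n)"
  have "?f \<in> {0..<int n} \<rightarrow> ?B" "?B \<noteq> {}"
    using spoke_in_wheel[OF n_pos] by blast+
  moreover have "finite ?B"
    by (simp add: edges_wheel)
  ultimately obtain q where q: "card {0..<int n} \<le> card (?f -` {q} \<inter> {0..<int n}) * card ?B"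
    using pigeonhole_card[of ?f "{0..<int n}" ?B] by auto
  define A where "A = ?f -` {q} \<inter> {0..<int n}"
  have "finite A"
    by (simp add: A_def)
  have "n \<le> card A * card ?B"
    using q by (simp add: A_def)
  also have "\<dots> \<le> card A * k"
    using few by (rule mult_le_mono2)
  finally have "m * k < card A * k"
    using assms by linarith
  then have "Suc m \<le> card A"
    by simp
  define xs where "xs = take (Suc m) (sorted_list_of_set A)"
  have "length xs = Suc m"
    using \<open>Suc m \<le> card A\<close> by (simp add: xs_def)
  moreover have "sorted_wrt (<) xs"
    unfolding xs_def by (intro sorted_wrt_take) simp
  moreover have "set xs \<subseteq> A"
    using set_take_subset[of "Suc m" "sorted_list_of_set A"] \<open>finite A\<close> by (simp add: xs_def)
  moreover from this have "set xs \<subseteq> {0..<int n}" "\<And>x. x \<in> set xs \<Longrightarrow> c (spoke n x) = q"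
    unfolding A_def by blast+
  ultimately show thesis
    using that[of xs] by simp
qed

end

section \<open>Fewer than two or three colours\<close>

lemma (in few_colors) two_colors_needed: "2 \<le> k"
proof -
  obtain V E where conn: "connector n c {rim_vertex n 0, rim_vertex n 1, rim_vertex n 2} V E"
    and card: "card V \<le> k + 1"
    by (rule rim_triple_connector[of 0 1 2]) (use n_ge_3 in simp_all)
  have "card {rim_vertex n 0, rim_vertex n 1, rim_vertex n 2} = 3"
    using n_ge_3 n_pos by (simp add: rim_vertex_eq_iff)
  moreover have "card {rim_vertex n 0, rim_vertex n 1, rim_vertex n 2} \<le> card V"
    using conn finite_subset[of V "{..n}"] by (intro card_mono) (auto simp: connector_def)
  ultimately show ?thesis
    using card by linarith
qed

lemma (in few_colors) two_colors_connector:
  assumes "k \<le> 2" "S \<subseteq> {..n}" "card S = 3"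
  obtains E where "connector n c S S E"
proof -
  obtain V E where conn: "connector n c S V E" and card: "card V \<le> k + 1"
    by (rule obtain_connector[OF n_ge_3 rainbow few assms(2,3)])
  have "S \<subseteq> V" "finite V"
    using conn finite_subset[of V "{..n}"] by (auto simp: connector_def)
  then have "S = V"
    using card assms(1,3) card_mono[of V S] by (intro card_subset_eq) auto
  then show thesis
    using that conn by blast
qed

text \<open>With two colours the tree has no further vertices, but 3 is not adjacent to 0 or 1.\<close>

lemma (in few_colors) three_colors_needed_if_ge_5:
  assumes "5 \<le> n"
  shows "3 \<le> k"
proof (rule ccontr)
  assume "\<not> 3 \<le> k"
  let ?S = "{rim_vertex n 0, rim_vertex n 1, rim_vertex n 3}"
  have S: "card ?S = 3" "?S \<subseteq> {..n}"
    using assms n_pos rim_vertex_less[OF n_pos] by (auto simp: rim_vertex_eq_iff intro: less_imp_le)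
  then obtain E where conn: "connector n c ?S ?S E"
    using two_colors_connector \<open>\<not> 3 \<le> k\<close> by (metis not_less_eq_eq numeral_3_eq_3 numeral_2_eq_2)
  have "{rim_vertex n 3} \<subset> ?S"
    using assms n_pos by (intro psubsetI) (auto simp: rim_vertex_eq_iff)
  then obtain v where v: "v \<in> ?S - {rim_vertex n 3}" "{rim_vertex n 3, v} \<in> E"
    by (rule connector_cut[OF conn]) auto
  have "rim_vertex n (3 + 1) \<notin> ?S" "rim_vertex n (3 - 1) \<notin> ?S" "n \<notin> ?S"
    using assms rim_vertex_less[OF n_pos, of 0] rim_vertex_less[OF n_pos, of 1] rim_vertex_less[OF n_pos, of 3]
    by (auto simp: rim_vertex_eq_iff n_pos)
  then show False
    using connector_neighbour[OF conn n_pos v(2)] v(1) by auto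
qed

text \<open>With two colours, adjacent rim edges and opposite spokes get different colours, and no triangle at
the hub is monochromatic. The rim is therefore coloured alternately, and each choice of the spokes at 0
and 1, which determines the opposite ones, creates a monochromatic triangle.\<close>

lemma (in few_colors) three_colors_needed_if_eq_4:
  assumes n4: "n = 4"
  shows "3 \<le> k"
proof (rule ccontr)
  assume "\<not> 3 \<le> k"
  then have k: "k \<le> 2"
    by simp
  have neq: "rim_vertex n i \<noteq> rim_vertex n j" if "i \<noteq> j" "\<bar>i - j\<bar> < 4" for i j
    using that n_pos by (simp add: rim_vertex_eq_iff n4)
  have not_hub: "rim_vertex n i \<noteq> n" for i
    using rim_vertex_less[OF n_pos, of i] by simp
  have le_n: "rim_vertex n i \<le> n" for i
    using rim_vertex_less[OF n_pos, of i] by simp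
  have rims: "c (rim n a) \<noteq> c (rim n (a + 1))" for a
  proof
    assume eq: "c (rim n a) = c (rim n (a + 1))"
    let ?S = "{rim_vertex n a, rim_vertex n (a + 1), rim_vertex n (a + 2)}"
    have "?S \<subseteq> {..n}" "card ?S = 3"
      using le_n by (auto simp: neq)
    then obtain E where conn: "connector n c ?S ?S E"
      by (rule two_colors_connector[OF k])
    have outside: "rim_vertex n (a - 1) \<notin> ?S" "rim_vertex n (a + 3) \<notin> ?S" "n \<notin> ?S"
      using not_hub[symmetric] by (auto simp: neq)
    have "{rim_vertex n a} \<subset> ?S"
      by (rule singleton_psubset[of _ _ "rim_vertex n (a + 1)"]) (simp_all add: neq)
    then obtain v where v: "v \<in> ?S - {rim_vertex n a}" "{rim_vertex n a, v} \<in> E"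
      by (rule connector_cut[OF conn]) auto
    then have "v = rim_vertex n (a + 1)"
      using connector_neighbour[OF conn n_pos v(2)] outside by auto
    then have 1: "rim n a \<in> E"
      using v(2) by (simp add: rim_def)
    have "{rim_vertex n (a + 2)} \<subset> ?S"
      by (rule singleton_psubset[of _ _ "rim_vertex n (a + 1)"]) (simp_all add: neq)
    then obtain v where v: "v \<in> ?S - {rim_vertex n (a + 2)}" "{rim_vertex n (a + 2), v} \<in> E"
      by (rule connector_cut[OF conn]) auto
    have "v = n \<or> v = rim_vertex n (a + 3) \<or> v = rim_vertex n (a + 1)"
      using connector_neighbour[OF conn n_pos v(2)] by (simp add: add.commute)
    then have "v = rim_vertex n (a + 1)"
      using v(1) outside by blast
    then have 2: "rim n (a + 1) \<in> E"
      using v(2) by (simp add: rim_def insert_commute add.assoc)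
    have "rim_vertex n a \<in> rim n (a + 1)"
      using connector_inj[OF conn 1 2 eq] by (auto simp: rim_def)
    then show False
      using neq[of a "a + 1"] neq[of a "a + 2"] by (simp add: rim_def add.assoc)
  qed
  have spokes: "c (spoke n a) \<noteq> c (spoke n (a + 2))" for a
  proof
    assume eq: "c (spoke n a) = c (spoke n (a + 2))"
    let ?S = "{rim_vertex n a, rim_vertex n (a + 2), n}"
    have "?S \<subseteq> {..n}" "card ?S = 3"
      using le_n not_hub by (auto simp: neq)
    then obtain E where conn: "connector n c ?S ?S E"
      by (rule two_colors_connector[OF k])
    have direct: "spoke n x \<in> E" if x: "x \<in> {a, a + 2}" for x
    proof -
      have "{rim_vertex n x} \<subset> ?S"
        by (rule singleton_psubset[of _ _ n]) (use x not_hub[of x] in auto)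
      then obtain v where v: "v \<in> ?S - {rim_vertex n x}" "{rim_vertex n x, v} \<in> E"
        by (rule connector_cut[OF conn]) auto
      have "rim_vertex n (x + 1) \<notin> ?S" "rim_vertex n (x - 1) \<notin> ?S"
        using x not_hub by (auto simp: neq)
      then have "v = n"
        using connector_neighbour[OF conn n_pos v(2)] v(1) by auto
      then show ?thesis
        using v(2) by (simp add: spoke_def insert_commute)
    qed
    have "rim_vertex n a = rim_vertex n (a + 2)"
      by (rule equal_spokes_of_connector[OF conn _ _ eq]) (simp_all add: direct)
    then show False
      using neq[of a "a + 2"] by simp
  qed
  have triangles: "c (spoke n (a + 1)) \<noteq> c (rim n a)" if eq: "c (spoke n a) = c (rim n a)" for a
  proof
    assume eq': "c (spoke n (a + 1)) = c (rim n a)"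
    let ?S = "{rim_vertex n a, rim_vertex n (a + 1), n}" and ?C = "{spoke n a, spoke n (a + 1), rim n a}"
    have "?S \<subseteq> {..n}" "card ?S = 3"
      using le_n not_hub by (auto simp: neq)
    then obtain E where conn: "connector n c ?S ?S E"
      by (rule two_colors_connector[OF k])
    \<comment> \<open>The three edges of the triangle have one colour, so the tree contains at most one of them, but
      it must cover all three vertices.\<close>
    have edge: "\<exists>e\<in>E. e \<in> ?C \<and> w \<in> e" if w: "w \<in> ?S" for w
    proof -
      have "{w} \<subset> ?S"
      proof (cases "w = n")
        case True
        show ?thesis
          by (rule singleton_psubset[of _ _ "rim_vertex n a"]) (use True not_hub[of a] in auto)
      next
        case False
        show ?thesis
          by (rule singleton_psubset[of _ _ n]) (use w False in auto)
      qed
      then obtain v where v: "v \<in> ?S - {w}" "{w, v} \<in> E"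
        by (rule connector_cut[OF conn]) auto
      have "{w, v} \<in> ?C"
        using w v(1) by (auto simp: spoke_def rim_def insert_commute)
      with v(2) show ?thesis
        by blast
    qed
    have same: "e = f" if "e \<in> E" "f \<in> E" "e \<in> ?C" "f \<in> ?C" for e f
    proof (rule connector_inj[OF conn that(1,2)])
      show "c e = c f"
        using that(3,4) eq eq' by auto
    qed
    obtain e where e: "e \<in> E" "e \<in> ?C" "n \<in> e"
      using edge[of n] by blast
    then have all: "w \<in> e" if "w \<in> ?S" for w
      using edge[OF that] same by blast
    have "card ?S = 3" "card e = 2"
      using e(2) not_hub not_hub[symmetric] neq[of a "a + 1"] by (auto simp: spoke_def rim_def)
    moreover have "?S \<subseteq> e"
      using all by blast
    moreover have "finite e"
      using e(2) by (auto simp: spoke_def rim_def)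
    ultimately show False
      using card_mono[of e ?S] by simp
  qed
  let ?C = "c ` edges (wheel n)"
  have two: "q = c (rim n 0) \<or> q = c (rim n 1)" if "q \<in> ?C" for q
  proof (rule ccontr)
    assume "\<not> ?thesis"
    then have "card {q, c (rim n 0), c (rim n 1)} = 3"
      using rims[of 0] by auto
    moreover have "card {q, c (rim n 0), c (rim n 1)} \<le> card ?C"
      using that rim_in_wheel[OF n_pos] by (intro card_mono) (auto simp: edges_wheel)
    ultimately show False
      using few k by linarith
  qed
  have rim4: "rim n 4 = rim n 0"
    using rim_vertex_add_period[of n 0] rim_vertex_add_period[of n 1] by (simp add: rim_def n4)
  have spoke4: "spoke n 4 = spoke n 0"
    using spoke_add_period[of n 0] by (simp add: n4)
  have r: "c (rim n 2) = c (rim n 0)" "c (rim n 3) = c (rim n 1)"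
    using two[OF imageI[OF rim_in_wheel[OF n_pos, of 2]]] two[OF imageI[OF rim_in_wheel[OF n_pos, of 3]]]
      rims[of 1] rims[of 3] rim4 by auto
  have s: "c (spoke n i) = c (rim n 0) \<or> c (spoke n i) = c (rim n 1)" for i
    using two[OF imageI[OF spoke_in_wheel[OF n_pos]]] .
  show False
    using s[of 0] s[of 1] s[of 2] s[of 3] r rims[of 0] spokes[of 0] spokes[of 1]
      triangles[of 0] triangles[of 1] triangles[of 2] triangles[of 3] spoke4
    by simp metis
qed

section \<open>Three colours are too few from seven rim vertices on\<close>

text \<open>The tree for the pairwise nonadjacent positions \<open>a, a + 2, a + 4\<close> has no further vertex besides the hub,
so it consists of their three spokes.\<close>

lemma (in few_colors) no_equal_spokes_at_distance_two:
  assumes "k \<le> 3" "7 \<le> n" and eq: "c (spoke n a) = c (spoke n (a + 2))"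
  shows False
proof -
  obtain V E where conn: "connector n c {rim_vertex n a, rim_vertex n (a + 2), rim_vertex n (a + 4)} V E"
    and card: "card V \<le> k + 1"
    by (rule rim_triple_connector[of a "a + 2" "a + 4"]) (use assms(2) in simp_all)
  let ?S = "{rim_vertex n a, rim_vertex n (a + 2), rim_vertex n (a + 4)}"
  have neq: "rim_vertex n i \<noteq> rim_vertex n j" if "i \<noteq> j" "\<bar>i - j\<bar> < int n" for i j
    using that n_pos by (simp add: rim_vertex_eq_iff)
  have hub: "n \<in> V"
    by (rule hub_in_connector[OF conn, of 4]) (use card assms(1,2) in linarith)+
  have not_hub: "rim_vertex n i \<noteq> n" for i
    using rim_vertex_less[OF n_pos, of i] by simp
  have V: "insert n ?S \<subseteq> V" "finite V"
    using conn hub finite_subset[of V "{..n}"] by (auto simp: connector_def)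
  have "card (insert n ?S) = 4"
    using assms(2) not_hub[symmetric] by (simp add: neq)
  then have V_eq: "V = insert n ?S"
    using card_subset_eq[OF V(2,1)] card_mono[OF V(2,1)] card assms(1) by simp
  have direct: "spoke n x \<in> E" if "x \<in> {a, a + 2}" for x
  proof -
    have "{rim_vertex n x} \<subset> V"
      using that V not_hub[of x] by (intro psubsetI) auto
    then obtain v where v: "v \<in> V - {rim_vertex n x}" "{rim_vertex n x, v} \<in> E"
      by (rule connector_cut[OF conn]) auto
    have "rim_vertex n (x + 1) \<notin> ?S" "rim_vertex n (x - 1) \<notin> ?S"
      using that assms(2) by (auto simp: rim_vertex_eq_iff n_pos)
    then have "v = n"
      using connector_neighbour[OF conn n_pos v(2)] v(1) V_eq by auto
    then show ?thesis
      using v(2) by (simp add: spoke_def insert_commute)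
  qed
  have "rim_vertex n a \<noteq> rim_vertex n (a + 2)"
    by (rule neq) (use assms(2) in simp_all)
  then show False
    using equal_spokes_of_connector[OF conn _ _ eq] direct by blast
qed

text \<open>The tree has no vertices besides the hub and the three positions. Hence it contains the spoke at the
isolated vertex \<open>a\<close> and, to connect the others, the spoke at \<open>b\<close> or \<open>d\<close>.\<close>

lemma (in few_colors) no_equal_spokes_with_one_isolated:
  assumes "k \<le> 3" "7 \<le> n"
    and far: "a + 3 \<le> b" "b < d" "d + 3 \<le> a + int n"
    and eq: "c (spoke n b) = c (spoke n a)" "c (spoke n d) = c (spoke n a)"
  shows False
proof -
  obtain V E where conn: "connector n c {rim_vertex n a, rim_vertex n b, rim_vertex n d} V E"
    and card: "card V \<le> k + 1"
    by (rule rim_triple_connector[of a b d]) (use far in simp_all)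
  let ?S = "{rim_vertex n a, rim_vertex n b, rim_vertex n d}"
  have neq: "rim_vertex n i \<noteq> rim_vertex n j" if "i \<noteq> j" "\<bar>i - j\<bar> < int n" for i j
    using that n_pos by (simp add: rim_vertex_eq_iff)
  have hub: "n \<in> V"
    by (rule hub_in_connector[OF conn, of 4]) (use card far assms(1,2) in linarith)+
  have not_hub: "rim_vertex n i \<noteq> n" for i
    using rim_vertex_less[OF n_pos, of i] by simp
  have V: "insert n ?S \<subseteq> V" "finite V"
    using conn hub finite_subset[of V "{..n}"] by (auto simp: connector_def)
  have "card (insert n ?S) = 4"
    using far not_hub[symmetric] by (simp add: neq)
  then have V_eq: "V = insert n ?S"
    using card_subset_eq[OF V(2,1)] card_mono[OF V(2,1)] card assms(1) by simp
  have "{rim_vertex n a} \<subset> V"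
    using V not_hub[of a] by (intro psubsetI) auto
  then obtain v where v: "v \<in> V - {rim_vertex n a}" "{rim_vertex n a, v} \<in> E"
    by (rule connector_cut[OF conn]) auto
  have "rim_vertex n (a + 1) \<notin> ?S" "rim_vertex n (a - 1) \<notin> ?S"
    using far by (auto simp: rim_vertex_eq_iff n_pos)
  then have "v = n"
    using connector_neighbour[OF conn n_pos v(2)] v(1) V_eq by auto
  then have direct: "spoke n a \<in> E"
    using v(2) by (simp add: spoke_def insert_commute)
  let ?U = "{rim_vertex n b, rim_vertex n d}"
  have "?U \<subset> V"
  proof
    show "?U \<subseteq> V"
      using V(1) by blast
    show "?U \<noteq> V"
      using hub not_hub[of b, symmetric] not_hub[of d, symmetric] by (metis insertE singletonD)
  qed
  then obtain u v where uv: "u \<in> ?U" "v \<in> V - ?U" "{u, v} \<in> E"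
    by (rule connector_cut[OF conn]) auto
  then obtain x where x: "x \<in> {b, d}" "u = rim_vertex n x"
    by blast
  have "rim_vertex n (x + 1) \<noteq> rim_vertex n a" "rim_vertex n (x - 1) \<noteq> rim_vertex n a"
    "rim_vertex n x \<noteq> rim_vertex n a"
    using x(1) far by (auto simp: rim_vertex_eq_iff n_pos)
  then have "v = n" and xa: "rim_vertex n x \<noteq> rim_vertex n a"
    using connector_neighbour[OF conn n_pos uv(3)[unfolded x(2)]] uv(2) V_eq not_hub[of a] by auto
  then have "spoke n x \<in> E"
    using uv(3) x(2) by (simp add: spoke_def insert_commute)
  moreover have "c (spoke n x) = c (spoke n a)"
    using x(1) eq by blast
  ultimately show False
    using equal_spokes_of_connector[OF conn _ direct] xa by blast
qed

text \<open>Take three equally coloured spokes. None of their gaps is 2, and two gaps equal to 1 would add up to distance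
2. So two of the three gaps are at least 3, and the vertex between them is isolated.\<close>

lemma (in few_colors) four_colors_needed:
  assumes "7 \<le> n"
  shows "4 \<le> k"
proof (rule ccontr)
  assume "\<not> 4 \<le> k"
  then have k: "k \<le> 3"
    by simp
  then have "2 * k < n"
    using assms by linarith
  then obtain xs where xs: "length xs = Suc 2" "sorted_wrt (<) xs" "set xs \<subseteq> {0..<int n}"
    "\<And>x y. x \<in> set xs \<Longrightarrow> y \<in> set xs \<Longrightarrow> c (spoke n x) = c (spoke n y)"
    using obtain_equal_spokes by blast
  then obtain x y z where l: "xs = [x, y, z]"
    by (auto simp: length_Suc_conv eval_nat_numeral)
  have order: "x < y" "y < z" "z < x + int n"
    using xs(2,3) unfolding l by auto
  have eq: "c (spoke n x) = c (spoke n z)" "c (spoke n y) = c (spoke n z)"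
    using xs(4) unfolding l by auto
  have dist: "c (spoke n i) \<noteq> c (spoke n (i + 2))" for i
    using no_equal_spokes_at_distance_two[OF k assms] by blast
  have "y \<noteq> x + 2" "z \<noteq> x + 2" "x + int n \<noteq> y + 2"
    using dist[of x] dist[of y] eq spoke_add_period[of n x] by metis+
  moreover have "z \<noteq> y + 2" "x + int n \<noteq> z + 2" "y + int n \<noteq> z + 2"
    using dist[of y] dist[of z] eq spoke_add_period[of n x] spoke_add_period[of n y] by metis+
  ultimately consider "x + 3 \<le> y" "z + 3 \<le> x + int n" | "y + 3 \<le> z" "x + 3 \<le> y" | "y + 3 \<le> z" "z + 3 \<le> x + int n"
    using order assms by linarith
  then show False
  proof cases
    case 1
    then show ?thesis
      by (intro no_equal_spokes_with_one_isolated[OF k assms, of x y z]) (use order eq in simp_all)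
  next
    case 2
    then show ?thesis
      by (intro no_equal_spokes_with_one_isolated[OF k assms, of y z "x + int n"])
        (use order eq in \<open>simp_all add: spoke_add_period\<close>)
  next
    case 3
    then show ?thesis
      by (intro no_equal_spokes_with_one_isolated[OF k assms, of z "x + int n" "y + int n"])
        (use order eq in \<open>simp_all add: spoke_add_period\<close>)
  qed
qed

section \<open>Four colours are too few from seventeen rim vertices on\<close>

text \<open>The tree has at most one vertex \<open>w\<close> besides the hub and the three positions. It is adjacent to at most one
of these, so any of them that does not use its own spoke is joined to the hub by the path
through \<open>w\<close>.\<close>

lemma far_triple_connector:
  assumes conn: "connector n c {rim_vertex n a, rim_vertex n b, rim_vertex n d} V E"
    and card: "card V \<le> 5"
    and far: "a + 3 \<le> b" "b + 3 \<le> d" "d + 3 \<le> a + int n"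
  shows "\<exists>w. \<forall>x\<in>{a, b, d}. spoke n x \<in> E \<or>
    (\<exists>y\<in>{x - 1, x + 1}. rim_vertex n y = w \<and> spoke n y \<in> E \<and> {rim_vertex n x, rim_vertex n y} \<in> E)"
proof -
  have n: "0 < n" "5 < n"
    using far by linarith+
  let ?S = "{rim_vertex n a, rim_vertex n b, rim_vertex n d}"
  have hub: "n \<in> V"
    by (rule hub_in_connector[OF conn card]) (use far n in linarith)+
  have distinct: "rim_vertex n a \<noteq> rim_vertex n b" "rim_vertex n a \<noteq> rim_vertex n d"
      "rim_vertex n b \<noteq> rim_vertex n d"
    using far n by (simp_all add: rim_vertex_eq_iff)
  have not_hub: "rim_vertex n i \<noteq> n" for i
    using rim_vertex_less[OF n(1), of i] by simp
  have V: "insert n ?S \<subseteq> V" "finite V"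
    using conn hub finite_subset[of V "{..n}"] by (auto simp: connector_def)
  have "card (insert n ?S) = 4"
    using distinct not_hub[symmetric] by simp
  then obtain w where w: "V \<subseteq> insert w (insert n ?S)"
    using card_le_Suc_obtain_extra[OF V(2,1)] card by auto
  have "spoke n x \<in> E \<or>
      (\<exists>y\<in>{x - 1, x + 1}. rim_vertex n y = w \<and> spoke n y \<in> E \<and> {rim_vertex n x, rim_vertex n y} \<in> E)"
    if x: "x \<in> {a, b, d}" for x
  proof (rule disjCI)
    assume *: "\<not> (\<exists>y\<in>{x - 1, x + 1}. rim_vertex n y = w \<and> spoke n y \<in> E \<and> {rim_vertex n x, rim_vertex n y} \<in> E)"
    have no_meet: "rim_vertex n (x + t) \<noteq> rim_vertex n z"
      if "z \<in> {a, b, d}" "z \<noteq> x" "\<bar>t\<bar> \<le> 2" for z t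
      using that x far n by (subst rim_vertex_eq_iff) auto
    have x_in: "rim_vertex n x \<in> V"
      using x V by auto
    \<comment> \<open>The other two positions are too far away, so \<open>x\<close> can only be adjacent to the hub and to \<open>w\<close>.\<close>
    have near: "v = n \<or> (\<exists>y\<in>{x - 1, x + 1}. v = rim_vertex n y \<and> w = rim_vertex n y)"
      if "v \<in> V - {rim_vertex n x}" "{rim_vertex n x, v} \<in> E" for v
    proof -
      from connector_neighbour[OF conn n(1) that(2)]
      consider "v = n" | y where "y \<in> {x - 1, x + 1}" "v = rim_vertex n y"
        by blast
      then show ?thesis
      proof cases
        case 2
        have "v \<noteq> rim_vertex n z" if "z \<in> {a, b, d}" for z
        proof (cases "z = x")
          case False
          then show ?thesis
            using no_meet[OF that False, of "y - x"] 2 by auto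
        qed (use \<open>v \<in> V - {rim_vertex n x}\<close> in auto)
        moreover have "v \<in> insert w (insert n ?S)"
          using w that(1) by blast
        ultimately have "v = w"
          using 2(2) not_hub[of y] by auto
        then show ?thesis
          using 2 by blast
      qed simp
    qed
    have "{rim_vertex n x} \<subset> V"
      using x_in hub not_hub[of x] by (intro psubsetI) auto
    then obtain v where v: "v \<in> V - {rim_vertex n x}" "{rim_vertex n x, v} \<in> E"
      by (rule connector_cut[OF conn]) auto
    show "spoke n x \<in> E"
    proof (cases "v = n")
      case True
      then show ?thesis
        using v(2) by (simp add: spoke_def insert_commute)
    next
      case False
      then obtain y where y: "y \<in> {x - 1, x + 1}" "v = rim_vertex n y" "w = rim_vertex n y"
        using near[OF v] by blast
      let ?U = "{rim_vertex n x, rim_vertex n y}"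
      have "?U \<subset> V"
        using x_in hub not_hub[of x] not_hub[of y] v(1) y(2) by (intro psubsetI) auto
      then obtain u v' where v': "u \<in> ?U" "v' \<in> V - ?U" "{u, v'} \<in> E"
        by (rule connector_cut[OF conn]) auto
      consider "u = rim_vertex n x" | "u = rim_vertex n y"
        using v'(1) by blast
      then show ?thesis
      proof cases
        case 1
        then have "v' = n"
          using near[of v'] v'(2,3) y(3) by blast
        then show ?thesis
          using v'(3) 1 by (simp add: spoke_def insert_commute)
      next
        case 2
        have "v' \<noteq> rim_vertex n z" if "z \<in> {a, b, d}" for z
        proof (cases "z = x")
          case False
          have "rim_vertex n (y + 1) \<noteq> rim_vertex n z" "rim_vertex n (y - 1) \<noteq> rim_vertex n z"
            using no_meet[OF that False, of "y + 1 - x"] no_meet[OF that False, of "y - 1 - x"] y(1) by auto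
          then show ?thesis
            using connector_neighbour[OF conn n(1) v'(3)[unfolded 2]] not_hub[of z] by metis
        qed (use v'(2) in auto)
        then have "v' = n"
          using w v'(2) y(3) by blast
        then have "spoke n y \<in> E"
          using v'(3) 2 by (simp add: spoke_def insert_commute)
        then show ?thesis
          using * y v(2) by blast
      qed
    qed
  qed
  then show ?thesis
    by (intro exI[of _ w] ballI)
qed

text \<open>The spokes at \<open>a\<close> and \<open>b\<close> cannot both be in the tree, so the additional vertex is used by one of
them. The other two positions then use their own spokes, and the tree has exactly four edges.\<close>

lemma (in few_colors) far_triple_with_equal_spokes:
  assumes "k \<le> 4"
    and far: "a + 3 \<le> b" "b + 3 \<le> d" "d + 3 \<le> a + int n"
    and eq: "c (spoke n a) = c (spoke n b)"
  obtains x y where "x \<in> {a, b}" "y \<in> {x - 1, x + 1}"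
    "distinct [c (spoke n a), c (spoke n d), c (spoke n y), c {rim_vertex n x, rim_vertex n y}]"
proof -
  obtain V E where conn: "connector n c {rim_vertex n a, rim_vertex n b, rim_vertex n d} V E" "card V \<le> k + 1"
    using rim_triple_connector[of a b d] far by auto
  then have card: "card V \<le> 5"
    using assms(1) by linarith
  obtain w where w: "\<forall>x\<in>{a, b, d}. spoke n x \<in> E \<or>
    (\<exists>y\<in>{x - 1, x + 1}. rim_vertex n y = w \<and> spoke n y \<in> E \<and> {rim_vertex n x, rim_vertex n y} \<in> E)"
    using far_triple_connector[OF conn(1) card far] ..
  have only_one: "spoke n z \<in> E"
    if xyz: "x \<in> {a, b, d}" "y \<in> {x - 1, x + 1}" "rim_vertex n y = w" "z \<in> {a, b, d}" "z \<noteq> x" for x y z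
  proof (rule ccontr)
    assume "spoke n z \<notin> E"
    then have "\<exists>y'\<in>{z - 1, z + 1}. rim_vertex n y' = w"
      using bspec[OF w xyz(4)] by blast
    then obtain y' where "y' \<in> {z - 1, z + 1}" "rim_vertex n y' = rim_vertex n y"
      unfolding xyz(3) ..
    then show False
      using xyz far n_pos by (subst (asm) rim_vertex_eq_iff) auto
  qed
  have ab: "rim_vertex n a \<noteq> rim_vertex n b"
    using far n_pos by (simp add: rim_vertex_eq_iff)
  have "\<not> (spoke n a \<in> E \<and> spoke n b \<in> E)"
    using equal_spokes_of_connector[OF conn(1) _ _ eq] ab by blast
  then obtain x where x: "x \<in> {a, b}" "spoke n x \<notin> E"
    by blast
  define z where "z = (if x = a then b else a)"
  have xz: "x \<in> {a, b, d}" "z \<in> {a, b, d}" "d \<in> {a, b, d}" "z \<noteq> x" "d \<noteq> x"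
    using x(1) far by (auto simp: z_def)
  obtain y where y: "y \<in> {x - 1, x + 1}" "rim_vertex n y = w" "spoke n y \<in> E"
      "{rim_vertex n x, rim_vertex n y} \<in> E"
    using bspec[OF w xz(1)] x(2) by blast
  have spokes: "spoke n z \<in> E" "spoke n d \<in> E"
    using only_one[OF xz(1) y(1,2)] xz by blast+
  have dist: "rim_vertex n z \<noteq> rim_vertex n d" "rim_vertex n z \<noteq> rim_vertex n y" "rim_vertex n d \<noteq> rim_vertex n y"
    using x(1) y(1) far n_pos by (auto simp: z_def rim_vertex_eq_iff)
  have "{rim_vertex n x, rim_vertex n y} \<noteq> spoke n i" for i
    using rim_vertex_less[OF n_pos, of x] rim_vertex_less[OF n_pos, of y] by (auto simp: spoke_def doubleton_eq_iff)
  then have "distinct [spoke n z, spoke n d, spoke n y, {rim_vertex n x, rim_vertex n y}]"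
    using dist n_pos by (auto simp: spoke_eq_iff)
  moreover have "inj_on c {spoke n z, spoke n d, spoke n y, {rim_vertex n x, rim_vertex n y}}"
    by (rule inj_on_subset[of c E]) (use conn(1) spokes y(3,4) in \<open>simp_all add: connector_def\<close>)
  ultimately have "distinct (map c [spoke n z, spoke n d, spoke n y, {rim_vertex n x, rim_vertex n y}])"
    by (subst distinct_map) simp
  moreover have "c (spoke n z) = c (spoke n a)"
    using eq by (simp add: z_def)
  ultimately show thesis
    using that[OF x(1) y(1)] by simp
qed

lemma (in few_colors) no_equal_spokes_at_far_triple:
  assumes "k \<le> 4" "a + 3 \<le> b" "b + 3 \<le> d" "d + 3 \<le> a + int n"
    and "c (spoke n a) = c (spoke n b)" "c (spoke n a) = c (spoke n d)"
  shows False
  using far_triple_with_equal_spokes[OF assms(1-5)] assms(6) by auto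

text \<open>The three spokes at \<open>a, a + 2, p\<close> are equally coloured, so at most one of them is in the tree. The only
vertex that could help two of them is \<open>a + 1\<close>, but its spoke has the same colour again.\<close>

lemma (in few_colors) no_equal_consecutive_spokes_and_far_one:
  assumes "k \<le> 4" and far: "a + 5 \<le> p" "p + 3 \<le> a + int n"
    and eq: "c (spoke n a) = c (spoke n p)" "c (spoke n (a + 1)) = c (spoke n p)"
      "c (spoke n (a + 2)) = c (spoke n p)"
  shows False
proof -
  obtain V E where conn: "connector n c {rim_vertex n a, rim_vertex n (a + 2), rim_vertex n p} V E" "card V \<le> k + 1"
    using rim_triple_connector[of a "a + 2" p] far by auto
  let ?S = "{rim_vertex n a, rim_vertex n (a + 2), rim_vertex n p}"
  have neq: "rim_vertex n i \<noteq> rim_vertex n j" if "i \<noteq> j" "\<bar>i - j\<bar> < int n" for i j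
    using that n_pos by (simp add: rim_vertex_eq_iff)
  have hub: "n \<in> V"
    by (rule hub_in_connector[OF conn(1), of 5]) (use conn(2) far assms(1) in linarith)+
  have not_hub: "rim_vertex n i \<noteq> n" for i
    using rim_vertex_less[OF n_pos, of i] by simp
  have V: "insert n ?S \<subseteq> V" "finite V"
    using conn hub finite_subset[of V "{..n}"] by (auto simp: connector_def)
  have "card (insert n ?S) = 4"
    using far not_hub[symmetric] by (simp add: neq)
  then obtain w where w: "V \<subseteq> insert w (insert n ?S)"
    using card_le_Suc_obtain_extra[OF V(2,1)] conn(2) assms(1) by auto
  have step: "spoke n x \<in> E \<or> w = rim_vertex n (x + 1) \<or> w = rim_vertex n (x - 1)"
    if "x \<in> {a, a + 2, p}" for x
  proof -
    have "{rim_vertex n x} \<subset> V"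
      using that V not_hub[of x] by (intro psubsetI) auto
    then obtain v where v: "v \<in> V - {rim_vertex n x}" "{rim_vertex n x, v} \<in> E"
      by (rule connector_cut[OF conn(1)]) auto
    have "rim_vertex n (x + 1) \<notin> ?S" "rim_vertex n (x - 1) \<notin> ?S"
      using that far by (auto simp: rim_vertex_eq_iff n_pos)
    then show ?thesis
      using connector_neighbour[OF conn(1) n_pos v(2)] v w by (auto simp: spoke_def insert_commute)
  qed
  have step2: "spoke n (a + 2) \<in> E \<or> w = rim_vertex n (a + 3) \<or> w = rim_vertex n (a + 1)"
    using step[of "a + 2"] by (simp add: add.commute)
  have no_two: "\<not> (spoke n x \<in> E \<and> spoke n y \<in> E)"
    if "x \<in> {a, a + 1, a + 2, p}" "y \<in> {a, a + 1, a + 2, p}" "x \<noteq> y" for x y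
  proof -
    have "c (spoke n x) = c (spoke n y)"
      using that eq by auto
    moreover have "rim_vertex n x \<noteq> rim_vertex n y"
      by (rule neq) (use that far in auto)
    ultimately show ?thesis
      using equal_spokes_of_connector[OF conn(1)] by blast
  qed
  \<comment> \<open>If \<open>p\<close> does not use its spoke, it needs the additional vertex \<open>w\<close>, which leaves \<open>a\<close> and \<open>a + 2\<close>
    with their own spokes. Otherwise both of them need \<open>w\<close>.\<close>
  show False
  proof (cases "spoke n p \<in> E")
    case False
    then have "w = rim_vertex n (p + 1) \<or> w = rim_vertex n (p - 1)"
      using step[of p] by simp
    moreover have "rim_vertex n (p + 1) \<noteq> rim_vertex n (a + 1)" "rim_vertex n (p + 1) \<noteq> rim_vertex n (a - 1)"
      "rim_vertex n (p - 1) \<noteq> rim_vertex n (a + 1)" "rim_vertex n (p - 1) \<noteq> rim_vertex n (a - 1)"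
      "rim_vertex n (p + 1) \<noteq> rim_vertex n (a + 3)" "rim_vertex n (p - 1) \<noteq> rim_vertex n (a + 3)"
      by (rule neq; use far in simp)+
    ultimately have "spoke n a \<in> E" "spoke n (a + 2) \<in> E"
      using step[of a] step2 by auto
    then show False
      using no_two[of a "a + 2"] by simp
  next
    case True
    then have "spoke n a \<notin> E" "spoke n (a + 2) \<notin> E"
      using no_two[of a p] no_two[of "a + 2" p] far by auto
    then have "w = rim_vertex n (a + 1) \<or> w = rim_vertex n (a - 1)" "w = rim_vertex n (a + 3) \<or> w = rim_vertex n (a + 1)"
      using step[of a] step2 by auto
    moreover have "rim_vertex n (a - 1) \<noteq> rim_vertex n (a + 3)" "rim_vertex n (a - 1) \<noteq> rim_vertex n (a + 1)"
      by (rule neq; use far in simp)+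
    ultimately have w_mid: "w = rim_vertex n (a + 1)"
      by auto
    let ?U = "V - {n, rim_vertex n p}"
    have "?U \<subset> V" "?U \<noteq> {}"
      using hub V not_hub[of a] neq[of a p] far by auto
    then obtain u v where uv: "u \<in> ?U" "v \<in> V - ?U" "{u, v} \<in> E"
      by (rule connector_cut[OF conn(1)])
    then obtain x where x: "x \<in> {a, a + 1, a + 2}" "u = rim_vertex n x"
      using w w_mid by blast
    have "v \<noteq> rim_vertex n p"
      using connector_neighbour[OF conn(1) n_pos uv(3)[unfolded x(2)]]
        neq[of "x + 1" p] neq[of "x - 1" p] x(1) far not_hub[of p] by auto
    then have "spoke n x \<in> E"
      using uv x(2) by (auto simp: spoke_def insert_commute)
    then show False
      using no_two[of x p] True x(1) far by auto
  qed
qed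

text \<open>The block from \<open>a\<close> to \<open>a + 4\<close> can only be left at \<open>a + 5\<close>, because the additional vertex
needs a spoke of another colour. So the spoke at any far position \<open>u\<close> has the one remaining colour,
and this applies to \<open>a + 7, a + 10, a + 13\<close>, which are pairwise far on a rim of 17 vertices.\<close>

lemma (in few_colors) no_five_consecutive_equal_spokes:
  assumes "k \<le> 4" "17 \<le> n"
    and eq: "\<And>i. i \<in> {0..4} \<Longrightarrow> c (spoke n (a + i)) = c (spoke n a)"
  shows False
proof -
  let ?C = "c ` edges (wheel n)"
  let ?third = "c (spoke n (a + 5))" and ?fourth = "c {rim_vertex n (a + 4), rim_vertex n (a + 5)}"
  have eqs: "c (spoke n (a + 1)) = c (spoke n a)" "c (spoke n (a + 2)) = c (spoke n a)"
    "c (spoke n (a + 3)) = c (spoke n a)" "c (spoke n (a + 4)) = c (spoke n a)"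
    using eq by auto
  have forced: "distinct [c (spoke n a), c (spoke n u), ?third, ?fourth]"
    if u: "a + 7 \<le> u" "u \<le> a + 13" for u
  proof -
    obtain x y where xy: "x \<in> {a + 1, a + 4}" "y \<in> {x - 1, x + 1}"
      "distinct [c (spoke n (a + 1)), c (spoke n u), c (spoke n y), c {rim_vertex n x, rim_vertex n y}]"
      by (rule far_triple_with_equal_spokes[of "a + 1" "a + 4" u]) (use assms(1,2) u eqs in simp_all)
    \<comment> \<open>The spoke at \<open>y\<close> has another colour than the block, so \<open>y\<close> is outside of it.\<close>
    have "y \<notin> {a, a + 2, a + 3}"
      using xy(3) eqs by auto
    then have "x = a + 4" "y = a + 5"
      using xy(1,2) by auto
    then show ?thesis
      using xy(3) eqs by simp
  qed
  have in_C: "{c (spoke n a), ?third, ?fourth} \<subseteq> ?C" "c (spoke n u) \<in> ?C" for u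
    using spoke_in_wheel[OF n_pos] rim_in_wheel[OF n_pos, of "a + 4"] by (auto simp: rim_def add.assoc)
  have unique: "c (spoke n u) = c (spoke n v)"
    if "a + 7 \<le> u" "u \<le> a + 13" "a + 7 \<le> v" "v \<le> a + 13" for u v
  proof (rule ccontr)
    assume "c (spoke n u) \<noteq> c (spoke n v)"
    then have "card {c (spoke n a), c (spoke n u), c (spoke n v), ?third, ?fourth} = 5"
      using forced[of u] forced[of v] that by auto
    moreover have "card {c (spoke n a), c (spoke n u), c (spoke n v), ?third, ?fourth} \<le> card ?C"
      using in_C by (intro card_mono) (auto simp: edges_wheel)
    ultimately show False
      using few assms(1) by linarith
  qed
  show False
    by (rule no_equal_spokes_at_far_triple[of "a + 7" "a + 10" "a + 13"]) (use assms(1,2) unique in auto)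
qed

text \<open>As \<open>x1, x3, x5\<close> are not pairwise far, one of the triples \<open>x1, x2, x3\<close> and \<open>x3, x4, x5\<close> is
consecutive. The remaining end of the sequence must then be near that triple, since the gap separates
it on the other side.\<close>

lemma (in few_colors) no_five_equal_spokes_after_gap:
  assumes "k \<le> 4" "17 \<le> n"
    and order: "x1 < x2" "x2 < x3" "x3 < x4" "x4 < x5" and gap: "x5 + 3 \<le> x1 + int n"
    and eq: "c (spoke n x2) = c (spoke n x1)" "c (spoke n x3) = c (spoke n x1)"
      "c (spoke n x4) = c (spoke n x1)" "c (spoke n x5) = c (spoke n x1)"
  shows False
proof -
  have close: "x3 = x1 + 2 \<or> x5 = x3 + 2"
  proof (rule ccontr)
    assume "\<not> ?thesis"
    then have "x1 + 3 \<le> x3" "x3 + 3 \<le> x5"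
      using order by linarith+
    then show False
      by (rule no_equal_spokes_at_far_triple[OF assms(1) _ _ gap eq(2)[symmetric] eq(4)[symmetric]])
  qed
  have x3: "x3 = x1 + 2"
  proof (rule ccontr)
    assume "x3 \<noteq> x1 + 2"
    then have *: "x1 + 3 \<le> x3" "x4 = x3 + 1" "x5 = x3 + 2"
      using close order by linarith+
    have "c (spoke n (x3 + 1)) = c (spoke n (x1 + int n))" "c (spoke n (x3 + 2)) = c (spoke n (x1 + int n))"
      "c (spoke n x3) = c (spoke n (x1 + int n))"
      using eq unfolding *(2,3) spoke_add_period by simp_all
    moreover have "x3 + 5 \<le> x1 + int n" "x1 + int n + 3 \<le> x3 + int n"
      using gap * by linarith+
    ultimately show False
      using no_equal_consecutive_spokes_and_far_one[OF assms(1)] by blast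
  qed
  have x5: "x5 = x3 + 2"
  proof (rule ccontr)
    assume "x5 \<noteq> x3 + 2"
    then have *: "x2 = x1 + 1" "x3 + 3 \<le> x5"
      using x3 order by linarith+
    have "c (spoke n (x1 + 1)) = c (spoke n x5)" "c (spoke n (x1 + 2)) = c (spoke n x5)"
      "c (spoke n x1) = c (spoke n x5)"
      using eq unfolding *(1) x3 by simp_all
    moreover have "x1 + 5 \<le> x5"
      using * x3 by linarith
    ultimately show False
      using no_equal_consecutive_spokes_and_far_one[OF assms(1) _ gap] by blast
  qed
  have x24: "x2 = x1 + 1" "x4 = x1 + 3"
    using x3 x5 order by linarith+
  have "c (spoke n (x1 + i)) = c (spoke n x1)" if "i \<in> {0..4}" for i
  proof -
    have "i = 0 \<or> i = 1 \<or> i = 2 \<or> i = 3 \<or> i = 4"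
      using that by auto
    then show ?thesis
      using eq unfolding x5 x3 x24 by (elim disjE) (simp_all add: add.assoc)
  qed
  then show False
    by (rule no_five_consecutive_equal_spokes[OF assms(1,2)])
qed

text \<open>Not all five gaps between equally coloured spokes are at most 2, and shifting representatives by a
period makes any of them the last one.\<close>

lemma (in few_colors) five_colors_needed:
  assumes "17 \<le> n"
  shows "5 \<le> k"
proof (rule ccontr)
  assume "\<not> 5 \<le> k"
  then have k: "k \<le> 4"
    by simp
  then have "4 * k < n"
    using assms by linarith
  then obtain xs where xs: "length xs = Suc 4" "sorted_wrt (<) xs" "set xs \<subseteq> {0..<int n}"
    "\<And>x y. x \<in> set xs \<Longrightarrow> y \<in> set xs \<Longrightarrow> c (spoke n x) = c (spoke n y)"
    using obtain_equal_spokes by blast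
  then obtain x1 x2 x3 x4 x5 where x: "xs = [x1, x2, x3, x4, x5]"
    by (auto simp: length_Suc_conv eval_nat_numeral)
  have order: "x1 < x2" "x2 < x3" "x3 < x4" "x4 < x5" "x5 < x1 + int n"
    using xs(2,3) unfolding x by auto
  have eq: "c (spoke n x2) = c (spoke n x1)" "c (spoke n x3) = c (spoke n x1)"
      "c (spoke n x4) = c (spoke n x1)" "c (spoke n x5) = c (spoke n x1)"
    using xs(4) unfolding x by auto
  note gap = no_five_equal_spokes_after_gap[OF k assms]
  have "x1 + int n < x5 + 3"
    by (rule ccontr, rule gap[of x1 x2 x3 x4 x5])
      (use order eq in \<open>simp_all add: spoke_add_period\<close>)
  moreover have "x2 < x1 + 3"
    by (rule ccontr, rule gap[of x2 x3 x4 x5 "x1 + int n"])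
      (use order eq in \<open>simp_all add: spoke_add_period\<close>)
  moreover have "x3 < x2 + 3"
    by (rule ccontr, rule gap[of x3 x4 x5 "x1 + int n" "x2 + int n"])
      (use order eq in \<open>simp_all add: spoke_add_period\<close>)
  moreover have "x4 < x3 + 3"
    by (rule ccontr, rule gap[of x4 x5 "x1 + int n" "x2 + int n" "x3 + int n"])
      (use order eq in \<open>simp_all add: spoke_add_period\<close>)
  moreover have "x5 < x4 + 3"
    by (rule ccontr, rule gap[of x5 "x1 + int n" "x2 + int n" "x3 + int n" "x4 + int n"])
      (use order eq in \<open>simp_all add: spoke_add_period\<close>)
  ultimately show False
    using assms by linarith
qed

section \<open>The 3-rainbow index of wheels\<close>

lemma rx3_eqI:
  fixes c :: "'a set \<Rightarrow> nat"
  assumes "rainbow_coloring3 G c" "card (c ` edges G) \<le> k"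
    and "\<And>d :: 'a set \<Rightarrow> nat. rainbow_coloring3 G d \<Longrightarrow> k \<le> card (d ` edges G)"
  shows "rx3 G = k"
proof -
  have "card (c ` edges G) = k"
    using assms(2) assms(3)[OF assms(1)] by (rule antisym)
  then show ?thesis
    unfolding rx3_def using assms(1,3) by (intro Least_equality) auto
qed

lemma few_colorsI:
  assumes "3 \<le> n" "rainbow_coloring3 (wheel n) c"
  shows "few_colors n (card (c ` edges (wheel n))) c"
  using assms by unfold_locales auto

theorem theorem7:
  fixes n :: nat
  assumes "n \<ge> 3"
  shows "rx3 (wheel n) =
    (if n = 3 then 2
     else if 4 \<le> n \<and> n \<le> 6 then 3
     else if 7 \<le> n \<and> n \<le> 16 then 4
     else 5)"
proof -
  note few = few_colorsI[OF assms]
  consider "n = 3" | "4 \<le> n" "n \<le> 6" | "7 \<le> n" "n \<le> 16" | "17 \<le> n"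
    using assms by linarith
  then show ?thesis
  proof cases
    case 1
    obtain c :: "nat set \<Rightarrow> nat" where "rainbow_coloring3 (wheel 3) c" "card (c ` edges (wheel 3)) \<le> 2"
      by (rule wheel_3_coloring)
    then have "rx3 (wheel n) = 2"
      unfolding 1 by (rule rx3_eqI) (rule few_colors.two_colors_needed[OF few_colorsI], simp_all)
    then show ?thesis
      using 1 by simp
  next
    case 2
    then have "n = 4 \<or> n = 5 \<or> n = 6"
      by linarith
    then have "\<exists>s r. list_coloring n 3 s r"
      using list_coloring_4 list_coloring_5 list_coloring_6 by blast
    then obtain c :: "nat set \<Rightarrow> nat" where c: "rainbow_coloring3 (wheel n) c" "card (c ` edges (wheel n)) \<le> 3"
      using list_coloring_rainbow assms by blast
    have "rx3 (wheel n) = 3"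
    proof (rule rx3_eqI[OF c])
      fix d :: "nat set \<Rightarrow> nat" assume "rainbow_coloring3 (wheel n) d"
      then interpret few_colors n "card (d ` edges (wheel n))" d
        by (rule few)
      show "3 \<le> card (d ` edges (wheel n))"
        using three_colors_needed_if_eq_4 three_colors_needed_if_ge_5 2(1) by (cases "n = 4") auto
    qed
    then show ?thesis
      using 2 by simp
  next
    case 3
    then have "n = 7 \<or> n = 8 \<or> n = 9 \<or> n = 10 \<or> n = 11 \<or> n = 12 \<or> n = 13 \<or> n = 14 \<or> n = 15 \<or> n = 16"
      by presburger
    then have "\<exists>s r. list_coloring n 4 s r"
      using list_coloring_7 list_coloring_8 list_coloring_9 list_coloring_10 list_coloring_11
        list_coloring_12 list_coloring_13 list_coloring_14 list_coloring_15 list_coloring_16 by blast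
    then obtain c :: "nat set \<Rightarrow> nat" where c: "rainbow_coloring3 (wheel n) c" "card (c ` edges (wheel n)) \<le> 4"
      using list_coloring_rainbow assms by blast
    have "rx3 (wheel n) = 4"
      by (rule rx3_eqI[OF c]) (rule few_colors.four_colors_needed[OF few 3(1)])
    then show ?thesis
      using 3 by simp
  next
    case 4
    have "rx3 (wheel n) = 5"
    proof (rule rx3_eqI)
      show "rainbow_coloring3 (wheel n) (wheel_coloring n (five_spokes n) five_rims)"
        using 4 by (intro five_coloring_rainbow) auto
      show "card (wheel_coloring n (five_spokes n) five_rims ` edges (wheel n)) \<le> 5"
        using 4 by (intro five_coloring_card) auto
    qed (rule few_colors.five_colors_needed[OF few 4])
    then show ?thesis
      using 4 by simp
  qed
qed

end
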